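(* Consider the quantized Riemannian gradient descent algorithm described in the context, with parameters $D,\eta,\gamma,\mu,\sigma,K,\theta,\xi,R^{(t)}$ as defined there. If $0<\eta\le\frac{\cos(D)}{\gamma}$, then the iterates $x^{(t)}$ and quantized gradients $q_i^{(t)}$, $q^{(t)}$ produced by the algorithm satisfy, for all $t\ge0$ and all $i=1,\dots,n$, $$\mathrm{dist}^2(x^{(t)},x^* )\le\xi^tD^2,\qquad \|q_i^{(t)}-\mathrm{grad}f_i(x^{(t)})\|\le\frac{\theta R^{(t)}}{2n},\qquad \|q^{(t)}-\mathrm{grad}f(x^{(t)})\|\le\theta R^{(t)}.$$
   Context: Setting. A data matrix $M\in\mathbb{R}^{m\times d}$ is partitioned row-wise among $n$ machines; machine $i$ holds $M_i$. Put $A_i=M_i^TM_i$, $A=M^TM=\sum_{i=1}^nA_i$, $f_i(x)=-x^TA_ix$ and $f(x)=-x^TAx=\sum_{i=1}^n f_i(x)$ on the unit sphere $\mathbb{S}^{d-1}\subset\mathbb{R}^d$. Let $\lambda_1\ge\lambda_2\ge\dots$ be the eigenvalues of $A$, assume $\delta=\lambda_1-\lambda_2>0$, and put $\mu=\delta/2$. Let $\gamma_i=2\lambda_{\max}(A_i)$ and $\gamma=n\max_i\gamma_i$. Let $x^{(0)}\in\mathbb{S}^{d-1}$ be known to all machines, let $x^*\in\{v_1,-v_1\}$ be the unit leading eigenvector of $A$ closest to $x^{(0)}$, and let $0<D<\pi/2$ satisfy $\mathrm{dist}(x^{(0)},x^* )\le D$. Sphere notation. $T_x\mathbb{S}^{d-1}=x^\perp$;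 $\mathrm{grad}f(x)=(I-xx^T)\nabla f(x)$; $\mathrm{dist}(p,q)=\arccos\langle p,q\rangle$; $\exp_p(v)=\cos(\|v\|)p+\sin(\|v\|)v/\|v\|$ (with $\exp_p(0)=p$); $\Gamma_{x^{(t)}}^{x^{(t+1)}}$ is parallel transport from $T_{x^{(t)}}\mathbb{S}^{d-1}$ to $T_{x^{(t+1)}}\mathbb{S}^{d-1}$ along the geodesic joining the two points. Quantization. $Q:\mathbb{R}^{d-1}\times\mathbb{R}^{d-1}\times\mathbb{R}_+\times\mathbb{R}_+\to\mathbb{R}^{d-1}$ is a fixed (deterministic lattice) quantization function: for $y,w>0$ there are an encoder $\mathrm{enc}_{w,y}:\mathbb{R}^{d-1}\to\{0,1\}^b$ and a decoder $\mathrm{dec}_{w,y}:\{0,1\}^b\times\mathbb{R}^{d-1}\to\mathbb{R}^{d-1}$ such that whenever $\|x-x'\|\le y$, $\mathrm{dec}_{w,y}(\mathrm{enc}_{w,y}(x),x')=Q(x,x',y,w)$ and $\|Q(x,x',y,w)-x\|\le w$; if $y/w>1$ the number of bits is $b=O(d\log(y/w))$. The decoded vector is the lattice point closest to $x$, so it is the same for all admissible $x'$. $Q_x$ denotes $Q$ applied in $T_x\mathbb{S}^{d-1}$, identified with $\mathbb{R}^{d-1}$ by a linear isometry. Parameters. $\sigma=1-\cos(D)\mu\eta$ if $\cos(D)\mu\eta\le\frac12$ and $\sigma=\frac12$ otherwise; $K=\frac{2}{\sqrt\sigma}$; $\theta=\frac{\sqrt\sigma(1-\sqrt\sigma)}{4}$;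 $\sqrt\xi=\theta K+\sqrt\sigma$; $R^{(t)}=\gamma K(\sqrt\xi)^tD$. A master machine $i_0$ is fixed. Algorithm. Initialization at $x^{(0)}$: each machine $i$ encodes its gradient and the master decodes $q_i^{(0)}=Q_{x^{(0)}}\big(\mathrm{grad}f_i(x^{(0)}),\mathrm{grad}f_{i_0}(x^{(0)}),2\gamma\pi,\frac{\theta R^{(0)}}{2n}\big)$; the master sums $r^{(0)}=\sum_{i=1}^nq_i^{(0)}$, encodes the sum, and each machine $i$ decodes $q^{(0)}=Q_{x^{(0)}}\big(r^{(0)},\mathrm{grad}f_i(x^{(0)}),\frac{\theta R^{(0)}}{2}+2\gamma\pi,\frac{\theta R^{(0)}}{2}\big)$. For $t\ge0$: $x^{(t+1)}=\exp_{x^{(t)}}(-\eta q^{(t)})$; the master decodes $q_i^{(t+1)}=Q_{x^{(t+1)}}\big(\mathrm{grad}f_i(x^{(t+1)}),\Gamma_{x^{(t)}}^{x^{(t+1)}}q_i^{(t)},\frac{R^{(t+1)}}{n},\frac{\theta R^{(t+1)}}{2n}\big)$ for each $i$ and sums $r^{(t+1)}=\sum_{i=1}^nq_i^{(t+1)}$; it encodes the sum and each machine decodes $q^{(t+1)}=Q_{x^{(t+1)}}\big(r^{(t+1)},\Gamma_{x^{(t)}}^{x^{(t+1)}}q^{(t)},(1+\frac\theta2)R^{(t+1)},\frac{\theta R^{(t+1)}}{2}\big)$. *)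

theory Defs
  imports "HOL-Analysis.Analysis"
begin

definition eigenspace :: "real^'d^'d \<Rightarrow> real \<Rightarrow> (real^'d) set" where
  "eigenspace A l = {v. A *v v = l *\<^sub>R v}"

definition spectrum :: "real^'d^'d \<Rightarrow> real set" where
  "spectrum A = {l. \<exists>v. v \<noteq> 0 \<and> A *v v = l *\<^sub>R v}"

definition lambda_max :: "real^'d^'d \<Rightarrow> real" where
  "lambda_max A = Max (spectrum A)"

text \<open>The eigenvalues in decreasing order, each repeated according to the dimension of its
  eigenspace; the definition is meant for symmetric matrices, where this is also the algebraic
  multiplicity. The index starts at 1.\<close>

definition eigval :: "real^'d^'d \<Rightarrow> nat \<Rightarrow> real" where
  "eigval A k =
     rev (sorted_list_of_multiset
       (\<Sum>l\<in>spectrum A. replicate_mset (dim (eigenspace A l)) l)) ! (k - 1)"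

text \<open>The rows of \<open>M\<close> are partitioned by \<open>own\<close>, which sends a row index to the machine holding
  that row. The blocks \<open>M\<^sub>i\<close> have different numbers of rows, so the entries of the matrix
  \<open>M\<^sub>i\<^sup>T M\<^sub>i\<close> are written out as sums over the rows of machine \<open>i\<close>.\<close>

definition local_gram :: "real^'d^'m \<Rightarrow> ('m \<Rightarrow> 'n) \<Rightarrow> 'n \<Rightarrow> real^'d^'d" where
  "local_gram M own i = (\<chi> a b. \<Sum>r | own r = i. M $ r $ a * M $ r $ b)"

definition neg_quad_form :: "real^'d^'d \<Rightarrow> real^'d \<Rightarrow> real" where
  "neg_quad_form A x = - (x \<bullet> (A *v x))"

definition tangent_space :: "'a::euclidean_space \<Rightarrow> 'a set" where
  "tangent_space x = {v. x \<bullet> v = 0}"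

definition tangent_proj :: "'a::euclidean_space \<Rightarrow> 'a \<Rightarrow> 'a" where
  "tangent_proj x v = v - (x \<bullet> v) *\<^sub>R x"

definition gradient :: "('a::euclidean_space \<Rightarrow> real) \<Rightarrow> 'a \<Rightarrow> 'a" where
  "gradient f x = (THE g. GDERIV f x :> g)"

definition sphere_grad :: "('a::euclidean_space \<Rightarrow> real) \<Rightarrow> 'a \<Rightarrow> 'a" where
  "sphere_grad f x = tangent_proj x (gradient f x)"

definition sphere_dist :: "'a::euclidean_space \<Rightarrow> 'a \<Rightarrow> real" where
  "sphere_dist p q = arccos (p \<bullet> q)"

definition sphere_exp :: "'a::euclidean_space \<Rightarrow> 'a \<Rightarrow> 'a" where
  "sphere_exp p v =
     (if v = 0 then p else cos (norm v) *\<^sub>R p + (sin (norm v) / norm v) *\<^sub>R v)"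

text \<open>A tangent vector field \<open>V\<close> along a curve \<open>c\<close> on the sphere is parallel if its covariant
  derivative, i.e. the tangential part of its ordinary derivative, vanishes.\<close>

definition parallel_along :: "(real \<Rightarrow> 'a::euclidean_space) \<Rightarrow> (real \<Rightarrow> 'a) \<Rightarrow> bool" where
  "parallel_along c V \<longleftrightarrow>
     (\<forall>s\<in>{0..1}. V s \<in> tangent_space (c s) \<and>
        (\<exists>V'. (V has_vector_derivative V') (at s within {0..1}) \<and> tangent_proj (c s) V' = 0))"

text \<open>Transport from \<open>p\<close> to \<open>q\<close> along the minimizing geodesic \<open>s \<mapsto> exp\<^sub>p (s u)\<close>. That
  geodesic, and hence the value, is determined for tangent \<open>v\<close> and unit \<open>p\<close>, \<open>q\<close> with
  \<open>q \<noteq> - p\<close>; for antipodal points the value is unspecified.\<close>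

definition parallel_transport :: "'a::euclidean_space \<Rightarrow> 'a \<Rightarrow> 'a \<Rightarrow> 'a" where
  "parallel_transport p q v =
     (THE w. \<exists>u V. u \<in> tangent_space p \<and> sphere_exp p u = q \<and> norm u = sphere_dist p q \<and>
        parallel_along (\<lambda>s. sphere_exp p (s *\<^sub>R u)) V \<and> V 0 = v \<and> V 1 = w)"

definition is_full_lattice :: "'e::euclidean_space set \<Rightarrow> bool" where
  "is_full_lattice L \<longleftrightarrow>
     (\<exists>B. independent B \<and> span B = UNIV \<and>
        L = range (\<lambda>c::'e \<Rightarrow> int. \<Sum>b\<in>B. of_int (c b) *\<^sub>R b))"

text \<open>\<open>Q x x' y w\<close> is what a decoder knowing \<open>x'\<close> recovers from the \<open>b y w\<close> bits that encode \<open>x\<close>.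
  The map \<open>near\<close> is a closest-point map of the lattice with a fixed choice in case of ties.
  Because \<open>Q x x' y w = near x\<close>, the decoded vector does not depend on the admissible \<open>x'\<close>.

  The bound \<open>O(d log(y/w))\<close> on the number of bits, where \<open>d\<close> is one more than the dimension of the
  quantized space, is required only from some threshold \<open>\<rho> > 1\<close> of the ratio \<open>y / w\<close> on: with one
  constant for all ratios above 1 it would force zero bits when \<open>y / w\<close> is close to 1, which is
  impossible.\<close>

definition lattice_quantization ::
  "('e::euclidean_space \<Rightarrow> 'e \<Rightarrow> real \<Rightarrow> real \<Rightarrow> 'e) \<Rightarrow> bool" where
  "lattice_quantization Q \<longleftrightarrow>
     (\<exists>(b::real \<Rightarrow> real \<Rightarrow> nat) C \<rho>. \<rho> > 1 \<and>
        (\<forall>y>0. \<forall>w>0.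
           (\<exists>(enc::'e \<Rightarrow> bool list) dec L near.
              (\<forall>x. length (enc x) = b y w) \<and>
              is_full_lattice L \<and>
              (\<forall>x. near x \<in> L \<and> (\<forall>z\<in>L. dist x (near x) \<le> dist x z)) \<and>
              (\<forall>x x'. norm (x - x') \<le> y \<longrightarrow>
                 dec (enc x) x' = Q x x' y w \<and>
                 norm (Q x x' y w - x) \<le> w \<and>
                 Q x x' y w = near x)) \<and>
           (y / w \<ge> \<rho> \<longrightarrow>
              real (b y w) \<le> C * real (DIM('e) + 1) * log 2 (y / w))))"

text \<open>A choice, for every point of the sphere, of a linear isometry from a Euclidean space onto the
  tangent space at that point.\<close>

definition tangent_frame :: "('a::euclidean_space \<Rightarrow> 'e::euclidean_space \<Rightarrow> 'a) \<Rightarrow> bool" where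
  "tangent_frame \<phi> \<longleftrightarrow>
     (\<forall>x\<in>sphere 0 1. linear (\<phi> x) \<and> (\<forall>u. norm (\<phi> x u) = norm u) \<and>
        range (\<phi> x) = tangent_space x)"

definition tangent_quant ::
  "('a::euclidean_space \<Rightarrow> 'e::euclidean_space \<Rightarrow> 'a) \<Rightarrow>
   ('e \<Rightarrow> 'e \<Rightarrow> real \<Rightarrow> real \<Rightarrow> 'e) \<Rightarrow>
   'a \<Rightarrow> 'a \<Rightarrow> 'a \<Rightarrow> real \<Rightarrow> real \<Rightarrow> 'a" where
  "tangent_quant \<phi> Q x v v' y w = \<phi> x (Q (inv (\<phi> x) v) (inv (\<phi> x) v') y w)"

text \<open>The arguments are the quantizer \<open>Qx\<close> in the tangent spaces, the local gradients \<open>g i\<close>, the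
  master \<open>i0\<close>, the parameters, the starting point \<open>x0\<close>, and the sequences of iterates \<open>x\<close>, of
  decoded local gradients \<open>qs t i\<close> and of decoded sums \<open>q\<close>.

  In the initial round every machine decodes the broadcast sum relative to its own gradient. Here
  \<open>q 0\<close> is the vector decoded by machine \<open>j\<close>; with \<open>j\<close> arbitrary, this covers every machine
  without presupposing that all of them decode the same vector.\<close>

definition quantized_rgd ::
  "('a \<Rightarrow> 'a \<Rightarrow> 'a \<Rightarrow> real \<Rightarrow> real \<Rightarrow> 'a::euclidean_space) \<Rightarrow> ('n::finite \<Rightarrow> 'a \<Rightarrow> 'a) \<Rightarrow>
   'n \<Rightarrow> 'n \<Rightarrow> real \<Rightarrow> real \<Rightarrow> real \<Rightarrow> (nat \<Rightarrow> real) \<Rightarrow> 'a \<Rightarrow>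
   (nat \<Rightarrow> 'a) \<Rightarrow> (nat \<Rightarrow> 'n \<Rightarrow> 'a) \<Rightarrow> (nat \<Rightarrow> 'a) \<Rightarrow> bool" where
  "quantized_rgd Qx g i0 j \<eta> \<gamma> \<theta> R x0 x qs q \<longleftrightarrow>
     x 0 = x0 \<and>
     (\<forall>i. qs 0 i =
        Qx x0 (g i x0) (g i0 x0) (2 * \<gamma> * pi) (\<theta> * R 0 / (2 * real CARD('n)))) \<and>
     q 0 =
        Qx x0 (\<Sum>i\<in>UNIV. qs 0 i) (g j x0) (\<theta> * R 0 / 2 + 2 * \<gamma> * pi) (\<theta> * R 0 / 2) \<and>
     (\<forall>t. x (Suc t) = sphere_exp (x t) (- (\<eta> *\<^sub>R q t)) \<and>
        (\<forall>i. qs (Suc t) i =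
           Qx (x (Suc t)) (g i (x (Suc t))) (parallel_transport (x t) (x (Suc t)) (qs t i))
             (R (Suc t) / real CARD('n)) (\<theta> * R (Suc t) / (2 * real CARD('n)))) \<and>
        q (Suc t) =
           Qx (x (Suc t)) (\<Sum>i\<in>UNIV. qs (Suc t) i)
             (parallel_transport (x t) (x (Suc t)) (q t))
             ((1 + \<theta> / 2) * R (Suc t)) (\<theta> * R (Suc t) / 2))"

end

theory Submission
  imports Defs
begin

text \<open>Induction on \<open>t\<close>. The exponential map of the sphere does not increase distances between short
  tangent vectors (nonnegative curvature), so the quantization error moves the iterate by at most
  \<open>\<eta> \<theta> R\<close> away from the exact gradient step. The exact step contracts the distance to \<open>x\<^sup>*\<close> by the
  factor \<open>sqrt \<sigma>\<close>; this combines weak quasi-convexity and quadratic growth of the Rayleigh quotient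
  with \<open>\<parallel>grad f\<parallel>\<^sup>2 \<le> 2 \<gamma> (f - f\<^sup>*)\<close>. The two contributions add up to \<open>\<theta> K + sqrt \<sigma> = sqrt \<xi>\<close>.
  The local gradients are Lipschitz up to parallel transport, hence the transported old vectors lie
  within the radius that the quantizer needs at the next point.\<close>

section \<open>Geometry of the unit sphere\<close>

text \<open>The constants balance each other. With s = sqrt \<sigma>, the choice K = 2 / s gives
  \<theta> K = (1 - s) / 2 and sqrt \<xi> = (1 + s) / 2: half of the gap between s and 1 pays for
  quantization, the other half remains as decay. Consecutive iterates are at most 2 (sqrt \<xi>)^t D
  apart, because both are close to \<open>xstar\<close>; the Lipschitz constant \<gamma> turns this
  into a gradient drift of exactly s R(t). The old quantization error adds at most \<theta> R(t),
  and K > 2 makes (\<theta> + s) R(t) fit into R(t + 1). The value \<mu> = \<delta> / 2 comes from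
  sin r \<ge> r / 2. The obstacle is staying in range. Comparing two exponentials requires tangent
  lengths with sum at most pi, and \<open>parallel_transport\<close> is a definite description that
  has to be shown unique, which fails at antipodal points. The bounds D < pi / 2 and \<eta> \<gamma>
  \<le> cos D \<le> 1 exclude both dangers.\<close>

lemma sin_over_decreasing:
  fixes x y :: real
  assumes "0 < x" "x \<le> y" "y \<le> pi"
  shows "sin y / y \<le> sin x / x"
proof -
  \<comment> \<open>This is the numerator of the derivative of sin z / z. It vanishes at 0, and its
    own derivative is - z sin z.\<close>
  have nonpos: "z * cos z - sin z \<le> 0" if "0 \<le> z" "z \<le> pi" for z :: real
  proof -
    have "z * cos z - sin z \<le> 0 * cos 0 - sin (0::real)"
    proof (rule DERIV_nonpos_imp_nonincreasing [OF \<open>0 \<le> z\<close>])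
      fix w assume "0 \<le> w" "w \<le> z"
      moreover have "((\<lambda>z. z * cos z - sin z) has_real_derivative - (w * sin w)) (at w)"
        by (auto intro!: derivative_eq_intros)
      ultimately show "\<exists>d. ((\<lambda>z. z * cos z - sin z) has_real_derivative d) (at w) \<and> d \<le> 0"
        using sin_ge_zero[of w] that by (intro exI[of _ "- (w * sin w)"]) auto
    qed
    then show ?thesis by simp
  qed
  show ?thesis
  proof (rule DERIV_nonpos_imp_nonincreasing [OF \<open>x \<le> y\<close>])
    fix w assume w: "x \<le> w" "w \<le> y"
    have "((\<lambda>z. sin z / z) has_real_derivative (w * cos w - sin w) / w^2) (at w)"
      using assms w by (auto intro!: derivative_eq_intros simp: power2_eq_square mult.commute)
    moreover have "(w * cos w - sin w) / w^2 \<le> 0"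
      using nonpos[of w] assms w by (simp add: divide_nonpos_nonneg)
    ultimately show "\<exists>d. ((\<lambda>z. sin z / z) has_real_derivative d) (at w) \<and> d \<le> 0"
      by blast
  qed
qed

text \<open>This is the tangent line inequality for the convex function \<open>s \<mapsto> cos (sqrt s)\<close>,
  with \<open>s = x\<^sup>2\<close>; the square root is avoided because it is not differentiable at 0.\<close>

lemma cos_ge_tangent_in_square:
  fixes x y :: real
  assumes x: "0 < x" "x \<le> pi" and y: "0 \<le> y" "y \<le> pi"
  shows "cos x - sin x / (2 * x) * (y\<^sup>2 - x\<^sup>2) \<le> cos y"
proof -
  \<comment> \<open>Up to a constant, \<open>h\<close> is cos minus its tangent in the variable z^2.
    Its derivative z (sin x / x - sin z / z) is nonpositive before x and nonnegative after it, so
    the minimum is at x.\<close>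
  define h where "h = (\<lambda>z. cos z + sin x / (2 * x) * z\<^sup>2)"
  have deriv: "(h has_real_derivative z * (sin x / x) - sin z) (at z)" for z
    unfolding h_def using x by (auto intro!: derivative_eq_intros)
  have sin_eq: "sin z = z * (sin z / z)" if "z \<ge> 0" for z :: real by simp
  have "h x \<le> h y"
  proof (cases "x \<le> y")
    case True
    show ?thesis
    proof (rule DERIV_nonneg_imp_nondecreasing [OF True])
      fix z assume z: "x \<le> z" "z \<le> y"
      have "sin z \<le> z * (sin x / x)"
        using sin_over_decreasing[of x z] x y z by (subst sin_eq) (auto intro!: mult_left_mono simp del: times_divide_eq_right)
      then show "\<exists>d. (h has_real_derivative d) (at z) \<and> 0 \<le> d"
        using deriv[of z] by (intro exI[of _ "z * (sin x / x) - sin z"]) auto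
    qed
  next
    case False
    then have "y \<le> x" by simp
    then show ?thesis
    proof (rule DERIV_nonpos_imp_nonincreasing)
      fix z assume z: "y \<le> z" "z \<le> x"
      have "z * (sin x / x) \<le> sin z"
      proof (cases "z = 0")
        case False
        then show ?thesis
          using sin_over_decreasing[of z x] x y z by (simp add: field_simps)
      qed simp
      then show "\<exists>d. (h has_real_derivative d) (at z) \<and> d \<le> 0"
        using deriv[of z] by (intro exI[of _ "z * (sin x / x) - sin z"]) auto
    qed
  qed
  then show ?thesis unfolding h_def by (simp add: algebra_simps)
qed

section \<open>Angular distance on the unit sphere\<close>

lemma abs_inner_le_1:
  fixes p q :: "'a::real_inner"
  assumes "norm p = 1" "norm q = 1"
  shows "\<bar>p \<bullet> q\<bar> \<le> 1"
  using Cauchy_Schwarz_ineq2[of p q] assms by simp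

lemma inner_self_unit: "norm p = 1 \<Longrightarrow> p \<bullet> p = 1" for p :: "'a::real_inner"
  by (simp add: dot_square_norm)

lemma sphere_dist_bounds:
  assumes "norm p = 1" "norm q = 1"
  shows "0 \<le> sphere_dist p q" "sphere_dist p q \<le> pi"
  using abs_inner_le_1[OF assms] by (auto simp: sphere_dist_def abs_le_iff intro: arccos_lbound arccos_ubound)

lemma cos_sphere_dist:
  assumes "norm p = 1" "norm q = 1"
  shows "cos (sphere_dist p q) = p \<bullet> q"
  using abs_inner_le_1[OF assms] by (simp add: sphere_dist_def cos_arccos_abs)

lemma sphere_dist_commute: "sphere_dist p q = sphere_dist q p"
  by (simp add: sphere_dist_def inner_commute)

lemma sphere_dist_leI:
  assumes "norm p = 1" "norm q = 1" "0 \<le> r" "r \<le> pi" "cos r \<le> p \<bullet> q"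
  shows "sphere_dist p q \<le> r"
  using assms cos_mono_le_eq[of r "sphere_dist p q"]
  by (simp add: cos_sphere_dist sphere_dist_bounds)

lemma norm_minus_inner_scaleR:
  fixes p q :: "'a::real_inner"
  assumes "norm p = 1" "norm q = 1"
  shows "(norm (p - (p \<bullet> q) *\<^sub>R q))\<^sup>2 = 1 - (p \<bullet> q)\<^sup>2"
  using inner_self_unit[OF assms(1)] inner_self_unit[OF assms(2)]
  unfolding power2_norm_eq_inner
  by (simp add: inner_diff inner_commute[of q p] power2_eq_square)

lemma norm_perp_part_sphere:
  assumes "norm p = 1" "norm q = 1"
  shows "norm (p - (p \<bullet> q) *\<^sub>R q) = sin (sphere_dist p q)"
proof (rule power2_eq_imp_eq)
  show "(norm (p - (p \<bullet> q) *\<^sub>R q))\<^sup>2 = (sin (sphere_dist p q))\<^sup>2"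
    unfolding norm_minus_inner_scaleR[OF assms] sin_squared_eq
    by (simp add: cos_sphere_dist assms)
  show "0 \<le> sin (sphere_dist p q)"
    using sphere_dist_bounds[OF assms] by (intro sin_ge_zero)
qed simp

text \<open>Split \<open>p\<close> and \<open>r\<close> into their parts along and orthogonal to
  \<open>q\<close>. The orthogonal parts have lengths equal to the sines of the distances, so
  Cauchy-Schwarz and the addition theorem bound p \<bullet> r from below by the cosine of the sum of
  the distances.\<close>

lemma sphere_dist_triangle:
  assumes p: "norm p = 1" and q: "norm q = 1" and r: "norm r = 1"
  shows "sphere_dist p r \<le> sphere_dist p q + sphere_dist q r"
proof (cases "sphere_dist p q + sphere_dist q r \<le> pi")
  case True
  have "\<bar>(p - (p \<bullet> q) *\<^sub>R q) \<bullet> (r - (r \<bullet> q) *\<^sub>R q)\<bar> \<le> sin (sphere_dist p q) * sin (sphere_dist q r)"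
    using Cauchy_Schwarz_ineq2[of "p - (p \<bullet> q) *\<^sub>R q" "r - (r \<bullet> q) *\<^sub>R q"]
    unfolding norm_perp_part_sphere[OF p q] norm_perp_part_sphere[OF r q]
    by (simp add: sphere_dist_commute[of q r])
  moreover have "(p - (p \<bullet> q) *\<^sub>R q) \<bullet> (r - (r \<bullet> q) *\<^sub>R q) = p \<bullet> r - (p \<bullet> q) * (q \<bullet> r)"
    using inner_self_unit[OF q] by (simp add: inner_diff inner_commute algebra_simps)
  ultimately have "cos (sphere_dist p q + sphere_dist q r) \<le> p \<bullet> r"
    by (simp add: cos_add cos_sphere_dist p q r)
  with True show ?thesis
    by (intro sphere_dist_leI) (auto simp: p q r sphere_dist_bounds)
next
  case False
  then show ?thesis using sphere_dist_bounds(2)[OF p r] by simp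
qed

section \<open>The exponential map and its inverse\<close>

lemma sphere_exp_sgn: "sphere_exp p u = cos (norm u) *\<^sub>R p + sin (norm u) *\<^sub>R sgn u"
  by (simp add: sphere_exp_def sgn_div_norm divide_inverse_commute mult.commute)

lemma inner_sphere_exp:
  assumes "norm p = 1" "u \<in> tangent_space p" "v \<in> tangent_space p"
  shows "sphere_exp p u \<bullet> sphere_exp p v =
    cos (norm u) * cos (norm v) + sin (norm u) * sin (norm v) * (sgn u \<bullet> sgn v)"
  using assms
  by (simp add: sphere_exp_sgn inner_add inner_self_unit tangent_space_def sgn_div_norm
      inner_commute[of u p])

lemma norm_sphere_exp:
  assumes "norm p = 1" "u \<in> tangent_space p"
  shows "norm (sphere_exp p u) = 1"
proof -
  have "sphere_exp p u \<bullet> sphere_exp p u = (cos (norm u))\<^sup>2 + (sin (norm u))\<^sup>2"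
    unfolding inner_sphere_exp[OF assms assms(2)]
    by (cases "u = 0") (auto simp: power2_eq_square dot_square_norm norm_sgn)
  then show ?thesis by (simp add: norm_eq_sqrt_inner)
qed

text \<open>For fixed lengths a and b, the squared planar distance and the inner product of the two
  endpoints are both affine in the cosine c of the angle. At c = 1 and c = -1 the planar distances
  |a - b| and a + b have exactly that inner product as cosine; convexity of cos as a function of the
  squared argument settles all c in between. The bound pi on the sum keeps both extremes in the
  range where this convexity holds.\<close>

lemma sphere_dist_exp_exp_le:
  assumes p: "norm p = 1" and u: "u \<in> tangent_space p" and v: "v \<in> tangent_space p"
    and le: "norm u + norm v \<le> pi"
  shows "sphere_dist (sphere_exp p u) (sphere_exp p v) \<le> norm (u - v)"
proof (rule sphere_dist_leI)
  show "norm (u - v) \<le> pi" using norm_triangle_ineq4[of u v] le by simp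
  show "cos (norm (u - v)) \<le> sphere_exp p u \<bullet> sphere_exp p v"
  proof (cases "u = v")
    case True
    then show ?thesis
      using norm_sphere_exp[OF p v] by (simp add: inner_self_unit)
  next
    case False
    define a b c where "a = norm u" and "b = norm v" and "c = sgn u \<bullet> sgn v"
    define s where "s = norm (u - v)"
    define k where "k = sin s / (2 * s)"
    have s: "0 < s" "s \<le> pi"
      using False \<open>norm (u - v) \<le> pi\<close> by (auto simp: s_def)
    have ab: "0 \<le> a" "0 \<le> b" "a + b \<le> pi" using le by (auto simp: a_def b_def)
    have c: "\<bar>c\<bar> \<le> 1"
      unfolding c_def using Cauchy_Schwarz_ineq2[of "sgn u" "sgn v"]
      by (auto simp: norm_sgn split: if_splits)
    have "u \<bullet> v = a * b * c"
      by (cases "u = 0 \<or> v = 0") (auto simp: a_def b_def c_def sgn_div_norm field_simps)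
    then have s2: "s\<^sup>2 = a\<^sup>2 + b\<^sup>2 - 2 * (a * b * c)"
      unfolding s_def a_def b_def by (simp add: power2_norm_eq_inner inner_diff inner_commute)
    have "cos s - k * (\<bar>a - b\<bar>\<^sup>2 - s\<^sup>2) \<le> cos \<bar>a - b\<bar>" "cos s - k * ((a + b)\<^sup>2 - s\<^sup>2) \<le> cos (a + b)"
      unfolding k_def using s ab by (intro cos_ge_tangent_in_square; linarith)+
    moreover have "cos \<bar>a - b\<bar> = cos a * cos b + sin a * sin b"
      by (simp add: cos_diff)
    moreover have "cos (a + b) = cos a * cos b - sin a * sin b"
      by (simp add: cos_add)
    ultimately have
      1: "cos s - k * ((a - b)\<^sup>2 - s\<^sup>2) \<le> cos a * cos b + sin a * sin b" and
      2: "cos s - k * ((a + b)\<^sup>2 - s\<^sup>2) \<le> cos a * cos b - sin a * sin b"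
      by simp_all
    \<comment> \<open>\<open>s\<^sup>2\<close> is the mean of the two extreme squared distances with
      weights (1 + c) / 2 and (1 - c) / 2, so the slope terms of the two tangent inequalities
      cancel.\<close>
    have "s\<^sup>2 = (1 + c) / 2 * (a - b)\<^sup>2 + (1 - c) / 2 * (a + b)\<^sup>2"
      unfolding s2 by (simp add: field_simps power2_eq_square)
    then have "(1 + c) / 2 * ((a - b)\<^sup>2 - s\<^sup>2) + (1 - c) / 2 * ((a + b)\<^sup>2 - s\<^sup>2) = 0"
      by (simp add: field_simps)
    moreover have "(1 + c) / 2 * (X - k * Y) + (1 - c) / 2 * (X - k * Z) =
        X - k * ((1 + c) / 2 * Y + (1 - c) / 2 * Z)" for X Y Z
      by (simp add: field_simps)
    ultimately have "cos s = (1 + c) / 2 * (cos s - k * ((a - b)\<^sup>2 - s\<^sup>2)) + (1 - c) / 2 * (cos s - k * ((a + b)\<^sup>2 - s\<^sup>2))"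
      by simp
    also have "\<dots> \<le> (1 + c) / 2 * (cos a * cos b + sin a * sin b) + (1 - c) / 2 * (cos a * cos b - sin a * sin b)"
      using c by (intro add_mono mult_left_mono 1 2) auto
    also have "\<dots> = cos a * cos b + sin a * sin b * c"
      by (simp add: field_simps)
    finally show ?thesis
      unfolding inner_sphere_exp[OF p u v] a_def b_def c_def s_def .
  qed
qed (auto simp: norm_sphere_exp p u v)

text \<open>For distances strictly between 0 and pi the sine can be divided out, which recovers the
  direction. At antipodal points every unit tangent direction would do.\<close>

lemma sphere_log_unique:
  assumes p: "norm p = 1"
    and "sphere_exp p u = q" "sphere_exp p v = q" "norm u = sphere_dist p q" "norm v = sphere_dist p q"
    and lt: "sphere_dist p q < pi"
  shows "u = v"
proof (cases "sphere_dist p q = 0")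
  case False
  then have pos: "0 < sphere_dist p q" using assms norm_ge_zero[of u] by linarith
  then have "sin (sphere_dist p q) > 0" using lt by (intro sin_gt_zero)
  moreover have "sin (norm u) *\<^sub>R sgn u = sin (norm v) *\<^sub>R sgn v"
    using assms unfolding sphere_exp_sgn by (metis add_left_cancel)
  ultimately have "sgn u = sgn v" using assms by simp
  then have "norm u *\<^sub>R sgn u = norm v *\<^sub>R sgn v" using assms by simp
  moreover have "norm w *\<^sub>R sgn w = w" for w :: 'a
    by (cases "w = 0") (simp_all add: sgn_div_norm)
  ultimately show ?thesis by simp
qed (use assms in auto)

lemma sphere_log_exists:
  assumes p: "norm p = 1" and q: "norm q = 1" and lt: "sphere_dist p q < pi"
  obtains u where "u \<in> tangent_space p" "sphere_exp p u = q" "norm u = sphere_dist p q"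
proof (cases "sphere_dist p q = 0")
  case True
  then have "p \<bullet> q = 1" using cos_sphere_dist[OF p q] by simp
  then have "(norm (p - q))\<^sup>2 = 0"
    by (simp add: power2_norm_eq_inner inner_diff inner_self_unit p q inner_commute)
  then show ?thesis
    using True by (intro that[of 0]) (auto simp: tangent_space_def sphere_exp_def)
next
  case False
  define r where "r = sphere_dist p q"
  have r: "0 < r" "r < pi"
    using False lt sphere_dist_bounds[OF p q] by (auto simp: r_def)
  then have s: "sin r > 0" by (intro sin_gt_zero)
  define e where "e = (1 / sin r) *\<^sub>R (q - (q \<bullet> p) *\<^sub>R p)"
  have e1: "norm e = 1"
    using s norm_perp_part_sphere[OF q p] by (simp add: e_def r_def sphere_dist_commute)
  have "sgn (r *\<^sub>R e) = e" "norm (r *\<^sub>R e) = r"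
    using r e1 by (simp_all add: sgn_div_norm)
  moreover have "cos r *\<^sub>R p + sin r *\<^sub>R e = q"
    using s cos_sphere_dist[OF p q] by (simp add: e_def r_def inner_commute)
  moreover have "r *\<^sub>R e \<in> tangent_space p"
    by (simp add: e_def tangent_space_def inner_diff inner_self_unit p inner_commute)
  ultimately show ?thesis
    using that[of "r *\<^sub>R e"] by (simp add: sphere_exp_sgn r_def)
qed

subsection \<open>Parallel fields along great circles\<close>

text \<open>A form of \<open>sphere_exp p (s *\<^sub>R u)\<close> without case distinction, hence
  easy to differentiate; since \<open>sgn 0 = 0\<close>, it is constant for u = 0.\<close>

definition great_circle :: "'a::euclidean_space \<Rightarrow> 'a \<Rightarrow> real \<Rightarrow> 'a" where
  "great_circle p u s = cos (s * norm u) *\<^sub>R p + sin (s * norm u) *\<^sub>R sgn u"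

text \<open>The unit velocity of the circle (zero if u = 0). Together with the position it forms a
  rotating frame of the plane of the circle.\<close>

definition great_circle_dir :: "'a::euclidean_space \<Rightarrow> 'a \<Rightarrow> real \<Rightarrow> 'a" where
  "great_circle_dir p u s = cos (s * norm u) *\<^sub>R sgn u - sin (s * norm u) *\<^sub>R p"

lemma great_circle_0 [simp]: "great_circle p u 0 = p"
  by (simp add: great_circle_def)

lemma great_circle_dir_0 [simp]: "great_circle_dir p u 0 = sgn u"
  by (simp add: great_circle_dir_def)

lemma sphere_exp_scaleR: "0 \<le> s \<Longrightarrow> sphere_exp p (s *\<^sub>R u) = great_circle p u s"
  by (cases "s = 0") (auto simp: sphere_exp_sgn great_circle_def sgn_scaleR)

lemma inner_sgn_sgn: "sgn u \<bullet> sgn u = (if u = 0 then 0 else 1)" for u :: "'a::real_inner"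
  by (simp add: dot_square_norm norm_sgn)

lemma inner_great_circle:
  assumes "norm p = 1" "u \<in> tangent_space p"
  shows "great_circle p u s \<bullet> great_circle_dir p u s = 0"
    and "great_circle p u s \<bullet> great_circle p u s = 1"
    and "u \<noteq> 0 \<Longrightarrow> great_circle_dir p u s \<bullet> great_circle_dir p u s = 1"
    and "u = 0 \<Longrightarrow> great_circle_dir p u s = 0"
proof -
  have "p \<bullet> sgn u = 0" "sgn u \<bullet> p = 0" "p \<bullet> p = 1"
    using assms by (auto simp: tangent_space_def sgn_div_norm inner_commute inner_self_unit)
  then show "great_circle p u s \<bullet> great_circle_dir p u s = 0"
    and "great_circle p u s \<bullet> great_circle p u s = 1"
    and "u \<noteq> 0 \<Longrightarrow> great_circle_dir p u s \<bullet> great_circle_dir p u s = 1"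
    and "u = 0 \<Longrightarrow> great_circle_dir p u s = 0"
    by (auto simp: great_circle_def great_circle_dir_def inner_add_left inner_add_right
        inner_diff_left inner_diff_right inner_sgn_sgn simp flip: power2_eq_square)
qed

lemma great_circle_has_vector_derivative [derivative_intros]:
  "(great_circle p u has_vector_derivative norm u *\<^sub>R great_circle_dir p u s) (at s within X)"
  unfolding great_circle_def[abs_def] great_circle_dir_def
  by (auto intro!: derivative_eq_intros simp: algebra_simps)

lemma great_circle_dir_has_vector_derivative [derivative_intros]:
  "(great_circle_dir p u has_vector_derivative - (norm u *\<^sub>R great_circle p u s)) (at s within X)"
  unfolding great_circle_def great_circle_dir_def[abs_def]
  by (auto intro!: derivative_eq_intros simp: algebra_simps)

text \<open>The part \<open>w\<close> orthogonal to the plane of the circle stays constant, and the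
  derivative of the velocity part is a multiple of the position, hence normal to the sphere.\<close>

lemma parallel_along_great_circle:
  assumes p: "norm p = 1" and u: "u \<in> tangent_space p" and w: "w \<bullet> p = 0" "w \<bullet> sgn u = 0"
  shows "parallel_along (\<lambda>s. sphere_exp p (s *\<^sub>R u)) (\<lambda>s. w + a *\<^sub>R great_circle_dir p u s)"
  unfolding parallel_along_def
proof (intro ballI conjI)
  fix s :: real assume s: "s \<in> {0..1}"
  have "great_circle p u s \<bullet> w = 0"
    using w by (simp add: great_circle_def inner_add inner_commute)
  then show "w + a *\<^sub>R great_circle_dir p u s \<in> tangent_space (sphere_exp p (s *\<^sub>R u))"
    using s inner_great_circle(1)[OF p u, of s]
    by (simp add: sphere_exp_scaleR tangent_space_def inner_add_right)
  have "((\<lambda>s. w + a *\<^sub>R great_circle_dir p u s) has_vector_derivative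
      a *\<^sub>R (- (norm u *\<^sub>R great_circle p u s))) (at s within {0..1})"
    by (auto intro!: derivative_eq_intros)
  moreover have "tangent_proj (sphere_exp p (s *\<^sub>R u)) (a *\<^sub>R (- (norm u *\<^sub>R great_circle p u s))) = 0"
    using s inner_great_circle(2)[OF p u, of s]
    by (simp add: sphere_exp_scaleR tangent_proj_def)
  ultimately show "\<exists>V'. ((\<lambda>s. w + a *\<^sub>R great_circle_dir p u s) has_vector_derivative V') (at s within {0..1}) \<and>
      tangent_proj (sphere_exp p (s *\<^sub>R u)) V' = 0"
    by blast
qed

lemma parallel_field_from:
  assumes p: "norm p = 1" and u: "u \<in> tangent_space p" and v: "v \<in> tangent_space p"
  obtains V where "parallel_along (\<lambda>s. sphere_exp p (s *\<^sub>R u)) V" "V 0 = v"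
proof
  have "(v - (v \<bullet> sgn u) *\<^sub>R sgn u) \<bullet> p = 0"
    using u v by (simp add: inner_diff tangent_space_def sgn_div_norm inner_commute)
  moreover have "(v - (v \<bullet> sgn u) *\<^sub>R sgn u) \<bullet> sgn u = 0"
    by (simp add: inner_diff_left inner_sgn_sgn)
  ultimately show "parallel_along (\<lambda>s. sphere_exp p (s *\<^sub>R u))
      (\<lambda>s. (v - (v \<bullet> sgn u) *\<^sub>R sgn u) + (v \<bullet> sgn u) *\<^sub>R great_circle_dir p u s)"
    by (intro parallel_along_great_circle p u)
qed simp

text \<open>The derivatives of both fields are normal and the fields themselves tangent, so the
  product rule gives derivative zero. Isometry of the transport and uniqueness of parallel fields
  both rest on this.\<close>

lemma parallel_along_inner_const:
  assumes V: "parallel_along c V" and W: "parallel_along c W" and s: "s \<in> {0..1}"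
  shows "V s \<bullet> W s = V 0 \<bullet> W 0"
proof -
  have "\<exists>k. \<forall>s\<in>{0..1}. V s \<bullet> W s = k"
  proof (rule has_field_derivative_zero_constant)
    fix s :: real assume s: "s \<in> {0..1}"
    obtain V' W' where
      V': "(V has_vector_derivative V') (at s within {0..1})" "tangent_proj (c s) V' = 0" and
      W': "(W has_vector_derivative W') (at s within {0..1})" "tangent_proj (c s) W' = 0"
      using V W s unfolding parallel_along_def by blast
    have tan: "c s \<bullet> V s = 0" "c s \<bullet> W s = 0"
      using V W s by (auto simp: parallel_along_def tangent_space_def)
    have "V' = (c s \<bullet> V') *\<^sub>R c s" "W' = (c s \<bullet> W') *\<^sub>R c s"
      using V'(2) W'(2) by (simp_all add: tangent_proj_def)
    then have "V s \<bullet> W' = 0" "V' \<bullet> W s = 0"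
      using tan by (metis inner_commute inner_scaleR_left mult_zero_right)+
    then show "((\<lambda>s. V s \<bullet> W s) has_real_derivative 0) (at s within {0..1})"
      using bounded_bilinear.has_vector_derivative[OF bounded_bilinear_inner V'(1) W'(1)]
      by (simp add: has_real_derivative_iff_has_vector_derivative)
  qed simp
  then show ?thesis using s by (metis atLeastAtMost_iff order_refl zero_le_one)
qed

lemma parallel_along_norm_diff_const:
  assumes V: "parallel_along c V" and W: "parallel_along c W" and s: "s \<in> {0..1}"
  shows "norm (V s - W s) = norm (V 0 - W 0)"
  using parallel_along_inner_const[OF V V s] parallel_along_inner_const[OF V W s]
    parallel_along_inner_const[OF W V s] parallel_along_inner_const[OF W W s]
  by (simp add: norm_eq_sqrt_inner inner_diff)

text \<open>Discharges the definite description: the logarithm \<open>u\<close> is unique below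
  distance pi, and two parallel fields with the same start keep distance zero.\<close>

lemma parallel_transport_eqI:
  assumes p: "norm p = 1" and lt: "sphere_dist p q < pi"
    and u: "u \<in> tangent_space p" "sphere_exp p u = q" "norm u = sphere_dist p q"
    and V: "parallel_along (\<lambda>s. sphere_exp p (s *\<^sub>R u)) V"
  shows "parallel_transport p q (V 0) = V 1"
  unfolding parallel_transport_def
proof (rule the_equality)
  fix w assume "\<exists>u' W. u' \<in> tangent_space p \<and> sphere_exp p u' = q \<and> norm u' = sphere_dist p q \<and>
    parallel_along (\<lambda>s. sphere_exp p (s *\<^sub>R u')) W \<and> W 0 = V 0 \<and> W 1 = w"
  then obtain u' W where *: "sphere_exp p u' = q" "norm u' = sphere_dist p q"
    "parallel_along (\<lambda>s. sphere_exp p (s *\<^sub>R u')) W" "W 0 = V 0" "W 1 = w"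
    by blast
  have "u' = u" using sphere_log_unique[OF p *(1) u(2) *(2) u(3) lt] .
  with * have "norm (W 1 - V 1) = norm (W 0 - V 0)"
    by (intro parallel_along_norm_diff_const[OF _ V]) auto
  with * show "w = V 1" by simp
qed (use u V in blast)

lemma parallel_transport_tangent:
  assumes p: "norm p = 1" and q: "norm q = 1" and lt: "sphere_dist p q < pi"
    and v: "v \<in> tangent_space p"
  shows "parallel_transport p q v \<in> tangent_space q"
proof -
  obtain u where u: "u \<in> tangent_space p" "sphere_exp p u = q" "norm u = sphere_dist p q"
    using sphere_log_exists[OF p q lt] .
  obtain V where V: "parallel_along (\<lambda>s. sphere_exp p (s *\<^sub>R u)) V" "V 0 = v"
    using parallel_field_from[OF p u(1) v] .
  have "V 1 \<in> tangent_space q"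
    using V(1) u(2) unfolding parallel_along_def
    by (metis atLeastAtMost_iff order_refl scaleR_one zero_le_one)
  then show ?thesis using parallel_transport_eqI[OF p lt u V(1)] V(2) by simp
qed

lemma norm_parallel_transport_diff:
  assumes p: "norm p = 1" and q: "norm q = 1" and lt: "sphere_dist p q < pi"
    and v: "v \<in> tangent_space p" and w: "w \<in> tangent_space p"
  shows "norm (parallel_transport p q v - parallel_transport p q w) = norm (v - w)"
proof -
  obtain u where u: "u \<in> tangent_space p" "sphere_exp p u = q" "norm u = sphere_dist p q"
    using sphere_log_exists[OF p q lt] .
  obtain V where V: "parallel_along (\<lambda>s. sphere_exp p (s *\<^sub>R u)) V" "V 0 = v"
    using parallel_field_from[OF p u(1) v] .
  obtain W where W: "parallel_along (\<lambda>s. sphere_exp p (s *\<^sub>R u)) W" "W 0 = w"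
    using parallel_field_from[OF p u(1) w] .
  show ?thesis
    using parallel_along_norm_diff_const[OF V(1) W(1), of 1]
      parallel_transport_eqI[OF p lt u V(1)] parallel_transport_eqI[OF p lt u W(1)] V(2) W(2)
    by simp
qed

section \<open>Gradients of quadratic forms on the sphere\<close>

text \<open>Polarization expresses y \<bullet> S z through the quadratic form at y + z and y - z;
  for unit vectors the squared norms of these two add up to 4 by the parallelogram law. Scaling
  gives the rest.\<close>

lemma selfadjoint_inner_bound:
  fixes S :: "'a::real_inner \<Rightarrow> 'a"
  assumes lin: "linear S" and sym: "\<And>y z. y \<bullet> S z = S y \<bullet> z"
    and bound: "\<And>y. \<bar>y \<bullet> S y\<bar> \<le> L * (norm y)\<^sup>2"
  shows "\<bar>y \<bullet> S z\<bar> \<le> L * norm y * norm z"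
proof -
  have unit: "\<bar>y \<bullet> S z\<bar> \<le> L" if "norm y = 1" "norm z = 1" for y z
  proof -
    have "4 * (y \<bullet> S z) = (y + z) \<bullet> S (y + z) - (y - z) \<bullet> S (y - z)"
      using sym[of y z]
      by (simp add: linear_add[OF lin] linear_diff[OF lin] inner_add inner_diff inner_commute)
    then have "\<bar>4 * (y \<bullet> S z)\<bar> \<le> L * (norm (y + z))\<^sup>2 + L * (norm (y - z))\<^sup>2"
      using bound[of "y + z"] bound[of "y - z"] by linarith
    also have "\<dots> = 4 * L"
      using that unfolding power2_norm_eq_inner
      by (simp add: inner_add inner_diff inner_commute[of z y] inner_self_unit algebra_simps)
    finally show ?thesis by simp
  qed
  have scale: "norm w *\<^sub>R sgn w = w" for w :: 'a
    by (cases "w = 0") (simp_all add: sgn_div_norm)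
  show ?thesis
  proof (cases "y = 0 \<or> z = 0")
    case False
    have "y \<bullet> S z = norm y * norm z * (sgn y \<bullet> S (sgn z))"
      using scale[of y] scale[of z]
      by (metis (no_types) inner_scaleR_left inner_scaleR_right linear_scale[OF lin] mult.assoc)
    then have "\<bar>y \<bullet> S z\<bar> = norm y * norm z * \<bar>sgn y \<bullet> S (sgn z)\<bar>"
      by (simp add: abs_mult)
    also have "\<dots> \<le> norm y * norm z * L"
      using False by (intro mult_left_mono unit) (auto simp: norm_sgn)
    finally show ?thesis by (simp add: mult_ac)
  qed (auto simp: linear_0[OF lin])
qed

lemma selfadjoint_norm_bound:
  fixes S :: "'a::real_inner \<Rightarrow> 'a"
  assumes "linear S" "\<And>y z. y \<bullet> S z = S y \<bullet> z" "\<And>y. \<bar>y \<bullet> S y\<bar> \<le> L * (norm y)\<^sup>2"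
  shows "norm (S z) \<le> L * norm z"
proof (cases "S z = 0")
  case True
  have "0 \<le> L * (norm z)\<^sup>2" using assms(3)[of z] abs_ge_zero order_trans by blast
  then show ?thesis using True
    by (cases "z = 0") (auto simp: zero_le_mult_iff)
next
  case False
  have "norm (S z) * norm (S z) \<le> L * norm (S z) * norm z"
    using selfadjoint_inner_bound[OF assms, of "S z" z] by (simp add: dot_square_norm power2_eq_square)
  then show ?thesis using False by (simp add: mult_ac)
qed

text \<open>For a transported test vector \<open>W\<close>, the derivative of \<open>W \<bullet> grad\<close> along the unit speed
  geodesic \<open>c\<close> is \<open>2 W \<bullet> ((c \<bullet> B c) c' - B c')\<close>, and the spectrum of \<open>(c \<bullet> B c) I - B\<close>
  lies in \<open>[- L, L]\<close>.\<close>

lemma parallel_transport_grad_lipschitz: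
  fixes B :: "'a::euclidean_space \<Rightarrow> 'a"
  assumes lin: "linear B" and sym: "\<And>y z. y \<bullet> B z = B y \<bullet> z"
    and psd: "\<And>y. 0 \<le> y \<bullet> B y" and bound: "\<And>y. y \<bullet> B y \<le> L * (norm y)\<^sup>2"
    and p: "norm p = 1" and q: "norm q = 1" and lt: "sphere_dist p q < pi"
  shows "norm (parallel_transport p q (tangent_proj p (- 2 *\<^sub>R B p)) - tangent_proj q (- 2 *\<^sub>R B q))
    \<le> 2 * L * sphere_dist p q"
proof -
  obtain u where u: "u \<in> tangent_space p" "sphere_exp p u = q" "norm u = sphere_dist p q"
    using sphere_log_exists[OF p q lt] .
  let ?c = "great_circle p u" and ?T = "great_circle_dir p u"
  have q_eq: "?c 1 = q" using sphere_exp_scaleR[of 1 p u] u(2) by simp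
  define G where "G = (\<lambda>y. tangent_proj y (- 2 *\<^sub>R B y))"
  have G: "G y \<in> tangent_space y" if "norm y = 1" for y
    using that by (simp add: G_def tangent_space_def tangent_proj_def inner_diff_right inner_self_unit)
  obtain V where V: "parallel_along (\<lambda>s. sphere_exp p (s *\<^sub>R u)) V" "V 0 = G p"
    using parallel_field_from[OF p u(1) G[OF p]] .
  have V1: "parallel_transport p q (G p) = V 1"
    using parallel_transport_eqI[OF p lt u V(1)] V(2) by simp
  define z where "z = V 1 - G q"
  have "V 1 \<in> tangent_space q"
    using parallel_transport_tangent[OF p q lt G[OF p]] V1 by simp
  then have z: "z \<bullet> q = 0"
    using G[OF q] by (simp add: z_def tangent_space_def inner_diff inner_commute)
  \<comment> \<open>The test field \<open>W\<close> is built backwards: it is the parallel field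
    that ends in the defect \<open>z\<close>, and \<open>a\<close> is its constant component along
    the velocity.\<close>
  define a where "a = z \<bullet> ?T 1"
  define w where "w = z - a *\<^sub>R ?T 1"
  define W where "W = (\<lambda>s. w + a *\<^sub>R ?T s)"
  have wT: "w \<bullet> ?T 1 = 0"
    using inner_great_circle(3,4)[OF p u(1), of 1]
    by (cases "u = 0") (auto simp: w_def a_def inner_diff_left)
  have wc: "w \<bullet> ?c 1 = 0"
    using z inner_great_circle(1)[OF p u(1), of 1]
    by (simp add: w_def q_eq inner_diff inner_commute)
  \<comment> \<open>Rotating the frame at the endpoint back by the angle \<open>norm u\<close>
    expresses \<open>p\<close> and \<open>sgn u\<close> in it; this transfers the orthogonality of
    \<open>w\<close> from \<open>q\<close> to \<open>p\<close>.\<close>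
  have p_eq: "p = cos (norm u) *\<^sub>R ?c 1 - sin (norm u) *\<^sub>R ?T 1"
  proof -
    have "cos (norm u) *\<^sub>R ?c 1 - sin (norm u) *\<^sub>R ?T 1 =
        (cos (norm u) * cos (norm u)) *\<^sub>R p + (sin (norm u) * sin (norm u)) *\<^sub>R p"
      by (simp add: great_circle_def great_circle_dir_def algebra_simps)
    also have "\<dots> = ((cos (norm u))\<^sup>2 + (sin (norm u))\<^sup>2) *\<^sub>R p"
      by (simp only: power2_eq_square scaleR_add_left)
    finally show ?thesis by simp
  qed
  have e_eq: "sgn u = sin (norm u) *\<^sub>R ?c 1 + cos (norm u) *\<^sub>R ?T 1"
  proof -
    have "sin (norm u) *\<^sub>R ?c 1 + cos (norm u) *\<^sub>R ?T 1 =
        (sin (norm u) * sin (norm u)) *\<^sub>R sgn u + (cos (norm u) * cos (norm u)) *\<^sub>R sgn u"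
      by (simp add: great_circle_def great_circle_dir_def algebra_simps)
    also have "\<dots> = ((sin (norm u))\<^sup>2 + (cos (norm u))\<^sup>2) *\<^sub>R sgn u"
      by (simp only: power2_eq_square scaleR_add_left)
    finally show ?thesis by simp
  qed
  have w_perp: "w \<bullet> p = 0" "w \<bullet> sgn u = 0"
    using wT wc by (subst p_eq e_eq, simp add: inner_diff_right inner_add_right)+
  have W: "parallel_along (\<lambda>s. sphere_exp p (s *\<^sub>R u)) W"
    unfolding W_def by (rule parallel_along_great_circle[OF p u(1) w_perp])
  have W1: "W 1 = z" by (simp add: W_def w_def)
  have nW: "norm (W s) = norm z" if "s \<in> {0..1}" for s
    using parallel_along_inner_const[OF W W that] parallel_along_inner_const[OF W W, of 1] W1
    by (simp add: norm_eq_sqrt_inner)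
  have WG: "W s \<bullet> G (?c s) = - 2 * (W s \<bullet> B (?c s))" if "s \<in> {0..1}" for s
  proof -
    have "W s \<bullet> ?c s = 0"
      using W that unfolding parallel_along_def tangent_space_def
      by (auto simp: sphere_exp_scaleR inner_commute)
    then show ?thesis by (simp add: G_def tangent_proj_def inner_diff_right)
  qed
  \<comment> \<open>Since W \<bullet> V is constant, the squared defect becomes the change of W
    \<bullet> G along the geodesic, which the mean value inequality can estimate.\<close>
  have "z \<bullet> z = W 1 \<bullet> V 1 - W 1 \<bullet> G q"
    by (simp add: W1 z_def inner_diff_right)
  also have "W 1 \<bullet> V 1 = W 0 \<bullet> G p"
    using parallel_along_inner_const[OF W V(1), of 1] V(2) by simp
  also have "W 0 \<bullet> G p - W 1 \<bullet> G q = 2 * (W 1 \<bullet> B (?c 1) - W 0 \<bullet> B (?c 0))"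
    using WG[of 0] WG[of 1] by (simp add: q_eq)
  finally have zz: "z \<bullet> z = 2 * (W 1 \<bullet> B (?c 1) - W 0 \<bullet> B (?c 0))" .
  define h' where "h' = (\<lambda>s. norm u * (W s \<bullet> B (?T s) - (?c s \<bullet> B (?c s)) * a))"
  have deriv: "((\<lambda>s. W s \<bullet> B (?c s)) has_real_derivative h' s) (at s within {0..1})" for s
  proof -
    have 1: "(W has_vector_derivative a *\<^sub>R (- (norm u *\<^sub>R ?c s))) (at s within {0..1})"
      unfolding W_def by (auto intro!: derivative_eq_intros)
    have 2: "((\<lambda>s. B (?c s)) has_vector_derivative B (norm u *\<^sub>R ?T s)) (at s within {0..1})"
      by (rule bounded_linear.has_vector_derivative[OF linear_conv_bounded_linear[THEN iffD1, OF lin]])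
         (rule great_circle_has_vector_derivative)
    show ?thesis
      using bounded_bilinear.has_vector_derivative[OF bounded_bilinear_inner 1 2]
      by (simp add: has_real_derivative_iff_has_vector_derivative h'_def linear_scale[OF lin] algebra_simps)
  qed
  have h'_le: "norm (h' s) \<le> norm u * (L * norm z)" if s: "s \<in> {0..1}" for s
  proof (cases "u = 0")
    case False
    define \<rho> where "\<rho> = ?c s \<bullet> B (?c s)"
    \<comment> \<open>Both terms of the derivative are merged into one operator. Its quadratic form
      is a difference of two quantities in [0, L], times the squared norm; separate estimates would
      double the constant.\<close>
    define S where "S = (\<lambda>y. B y - \<rho> *\<^sub>R y)"
    have nc: "norm (?c s) = 1" using inner_great_circle(2)[OF p u(1), of s] by (simp add: norm_eq_sqrt_inner)
    have nT: "norm (?T s) = 1" using inner_great_circle(3)[OF p u(1) False, of s] by (simp add: norm_eq_sqrt_inner)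
    have \<rho>: "0 \<le> \<rho>" "\<rho> \<le> L" using psd[of "?c s"] bound[of "?c s"] nc by (auto simp: \<rho>_def)
    have "W s \<bullet> ?T s = a"
    proof -
      have "w \<bullet> ?T s = 0" using w_perp by (simp add: great_circle_dir_def inner_diff_right)
      then show ?thesis using inner_great_circle(3)[OF p u(1) False, of s] by (simp add: W_def inner_add_left)
    qed
    then have eq: "h' s = norm u * (W s \<bullet> S (?T s))"
      by (simp add: h'_def S_def inner_diff_right \<rho>_def)
    have "\<bar>W s \<bullet> S (?T s)\<bar> \<le> L * norm (W s) * norm (?T s)"
    proof (rule selfadjoint_inner_bound)
      show "linear S"
        unfolding S_def by (intro linear_compose_sub lin linear_compose_scale_right linear_ident)
      show "y \<bullet> S z = S y \<bullet> z" for y z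
        by (simp add: S_def inner_diff sym)
      show "\<bar>y \<bullet> S y\<bar> \<le> L * (norm y)\<^sup>2" for y
      proof -
        have "0 \<le> \<rho> * (norm y)\<^sup>2" "\<rho> * (norm y)\<^sup>2 \<le> L * (norm y)\<^sup>2"
          using \<rho> by (auto intro: mult_right_mono)
        moreover have "y \<bullet> S y = y \<bullet> B y - \<rho> * (norm y)\<^sup>2"
          by (simp add: S_def inner_diff_right dot_square_norm)
        ultimately show ?thesis using psd[of y] bound[of y] by linarith
      qed
    qed
    then show ?thesis by (simp add: eq nT nW[OF s] abs_mult mult_left_mono)
  qed (simp add: h'_def)
  have "norm (W 1 \<bullet> B (?c 1) - W 0 \<bullet> B (?c 0)) \<le> norm u * (L * norm z) * norm (1 - 0 :: real)"
    by (rule field_differentiable_bound[OF convex_real_interval(5) deriv h'_le]) auto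
  then have "norm z * norm z \<le> norm z * (2 * L * norm u)"
    using zz by (simp add: dot_square_norm power2_eq_square mult_ac)
  moreover have "0 \<le> L"
    using psd[of p] bound[of p] p by simp
  ultimately have "norm z \<le> 2 * L * norm u"
    by (cases "z = 0") auto
  then show ?thesis using V1 u(3) by (simp add: z_def G_def)
qed

section \<open>Eigenvalues of symmetric matrices\<close>

text \<open>A maximizer of the quadratic form on the unit sphere of \<open>S\<close> exists by
  compactness and is an eigenvector by a variational argument. \<open>S\<close> is a parameter
  because the second eigenvalue needs the orthogonal complement of the first eigenvector.\<close>

lemma rayleigh_max_eigenvector:
  fixes B :: "'a::euclidean_space \<Rightarrow> 'a"
  assumes lin: "linear B" and sym: "\<And>y z. y \<bullet> B z = B y \<bullet> z"
    and S: "subspace S" and inv: "\<And>y. y \<in> S \<Longrightarrow> B y \<in> S" and nontriv: "y0 \<in> S" "y0 \<noteq> 0"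
  obtains v l where "v \<in> S" "norm v = 1" "B v = l *\<^sub>R v" "\<And>w. w \<in> S \<Longrightarrow> w \<bullet> B w \<le> l * (norm w)\<^sup>2"
proof -
  have "compact (S \<inter> sphere 0 1)"
    by (intro closed_Int_compact closed_subspace S compact_sphere)
  moreover have "sgn y0 \<in> S \<inter> sphere 0 1"
    using nontriv S by (simp add: sgn_div_norm subspace_scale)
  moreover have "continuous_on (S \<inter> sphere 0 1) (\<lambda>y. y \<bullet> B y)"
    using lin by (intro continuous_intros linear_continuous_on linear_conv_bounded_linear[THEN iffD1])
  ultimately obtain v where v: "v \<in> S" "norm v = 1"
    and max: "\<And>y. y \<in> S \<Longrightarrow> norm y = 1 \<Longrightarrow> y \<bullet> B y \<le> v \<bullet> B v"
    using continuous_attains_sup[of "S \<inter> sphere 0 1" "\<lambda>y. y \<bullet> B y"]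
    by (metis IntD1 IntD2 IntI empty_iff mem_sphere_0)
  define l where "l = v \<bullet> B v"
  have ray: "w \<bullet> B w \<le> l * (norm w)\<^sup>2" if "w \<in> S" for w
  proof (cases "w = 0")
    case False
    have "sgn w \<bullet> B (sgn w) \<le> l"
      unfolding l_def using that False S by (intro max) (auto simp: sgn_div_norm subspace_scale)
    then show ?thesis
      using False by (simp add: sgn_div_norm linear_scale[OF lin] field_simps power2_eq_square)
  qed (simp add: linear_0[OF lin])
  define N where "N = (\<lambda>y. l *\<^sub>R y - B y)"
  have N_nonneg: "0 \<le> y \<bullet> N y" if "y \<in> S" for y
    using ray[OF that] by (simp add: N_def inner_diff_right dot_square_norm)
  define z where "z = N v"
  have z: "z \<in> S" using v S inv by (simp add: z_def N_def subspace_diff subspace_scale)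
  have vN: "v \<bullet> N v = 0" using v by (simp add: N_def inner_diff_right dot_square_norm l_def)
  \<comment> \<open>Moving from \<open>v\<close> by - t z changes the nonnegative form of
    \<open>N\<close>, which vanishes at \<open>v\<close>, by a term - 2 t (z \<bullet> z) of first
    order and one of second order; dividing by t gives the claim.\<close>
  have key: "2 * (z \<bullet> z) \<le> t * (z \<bullet> N z)" if "t > 0" for t
  proof -
    have "v - t *\<^sub>R z \<in> S" using v z S by (simp add: subspace_diff subspace_scale)
    then have "0 \<le> (v - t *\<^sub>R z) \<bullet> N (v - t *\<^sub>R z)" by (rule N_nonneg)
    also have "\<dots> = v \<bullet> N v - 2 * t * (z \<bullet> N v) + t * t * (z \<bullet> N z)"
      using sym[of v z]
      by (simp add: N_def linear_diff[OF lin] linear_scale[OF lin] inner_diff inner_commute algebra_simps)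
    also have "\<dots> = t * (t * (z \<bullet> N z) - 2 * (z \<bullet> z))"
      using vN by (simp add: z_def algebra_simps)
    finally show ?thesis using that by (simp add: zero_le_mult_iff)
  qed
  have "z = 0"
  proof (rule ccontr)
    assume "z \<noteq> 0"
    then have pos: "z \<bullet> z > 0" by simp
    \<comment> \<open>Small enough to push the second-order term below z \<bullet> z; the + 1 avoids
      a zero denominator.\<close>
    define t where "t = (z \<bullet> z) / (\<bar>z \<bullet> N z\<bar> + 1)"
    have t: "t > 0" using pos by (simp add: t_def)
    have "t * (z \<bullet> N z) \<le> t * (\<bar>z \<bullet> N z\<bar> + 1)"
      using t by (intro mult_left_mono) auto
    also have "\<dots> = z \<bullet> z" by (simp add: t_def)
    finally show False using key[OF t] pos by linarith
  qed
  then have "B v = l *\<^sub>R v" by (simp add: z_def N_def)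
  then show ?thesis using that v ray by blast
qed

lemma symmetric_matrix_inner:
  fixes B :: "real^'d^'d"
  assumes "transpose B = B"
  shows "y \<bullet> (B *v z) = (B *v y) \<bullet> z"
  by (metis assms dot_lmul_matrix vector_transpose_matrix)

lemma eigenvectors_orthogonal:
  fixes B :: "real^'d^'d"
  assumes "transpose B = B" "B *v v = k *\<^sub>R v" "B *v w = l *\<^sub>R w" "k \<noteq> l"
  shows "v \<bullet> w = 0"
  using symmetric_matrix_inner[OF assms(1), of v w] assms(2-4) by auto

text \<open>Eigenvectors chosen for distinct eigenvalues are orthogonal, hence independent, hence
  finitely many. This gives \<open>Max\<close> and the multiset sum in \<open>lambda_max\<close> and
  \<open>eigval\<close> their intended meaning.\<close>

lemma finite_spectrum:
  fixes B :: "real^'d^'d"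
  assumes "transpose B = B"
  shows "finite (spectrum B)"
proof -
  have "\<forall>l\<in>spectrum B. \<exists>v. v \<noteq> 0 \<and> B *v v = l *\<^sub>R v" by (simp add: spectrum_def)
  then obtain e where e: "\<And>l. l \<in> spectrum B \<Longrightarrow> e l \<noteq> 0 \<and> B *v e l = l *\<^sub>R e l"
    by metis
  have orth: "e k \<bullet> e l = 0" if "k \<in> spectrum B" "l \<in> spectrum B" "k \<noteq> l" for k l
    using eigenvectors_orthogonal[OF assms, of "e k" k "e l" l] e that by blast
  have "inj_on e (spectrum B)"
    by (rule inj_onI) (metis e inner_eq_zero_iff orth)
  moreover have "independent (e ` spectrum B)"
    using e orth by (intro pairwise_orthogonal_independent) (auto simp: pairwise_def orthogonal_def)
  ultimately show ?thesis
    using finiteI_independent finite_imageD by blast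
qed

lemma rayleigh_le_lambda_max:
  fixes B :: "real^'d^'d"
  assumes "transpose B = B"
  shows "y \<bullet> (B *v y) \<le> lambda_max B * (norm y)\<^sup>2"
proof (cases "y = 0")
  case False
  obtain v l where vl: "norm v = 1" "B *v v = l *\<^sub>R v" "\<And>w. w \<bullet> (B *v w) \<le> l * (norm w)\<^sup>2"
    using rayleigh_max_eigenvector[of "(*v) B" UNIV y] symmetric_matrix_inner[OF assms] False
    by auto
  have "l \<in> spectrum B" using vl(1,2) by (auto simp: spectrum_def intro!: exI[of _ v])
  then have "l \<le> lambda_max B"
    unfolding lambda_max_def by (intro Max_ge finite_spectrum assms)
  then have "l * (norm y)\<^sup>2 \<le> lambda_max B * (norm y)\<^sup>2" by (intro mult_right_mono) auto
  then show ?thesis using vl(3)[of y] by linarith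
qed simp

lemma dim_eigenspace_pos:
  assumes "l \<in> spectrum A"
  shows "1 \<le> dim (eigenspace A l)"
proof -
  obtain v where v: "v \<noteq> 0" "v \<in> eigenspace A l"
    using assms by (auto simp: spectrum_def eigenspace_def)
  then show ?thesis
    using independent_card_le_dim[of "{v}" "eigenspace A l"] by simp
qed

lemma count_eigenvalue_multiset:
  assumes "finite (spectrum A)"
  shows "count (\<Sum>l\<in>spectrum A. replicate_mset (dim (eigenspace A l)) l) k =
    (if k \<in> spectrum A then dim (eigenspace A k) else 0)"
  using assms by (simp add: count_sum)

lemma hd_decreasing_list_of_multiset:
  fixes X :: "'a::linorder multiset"
  assumes "k \<in># X"
  shows "rev (sorted_list_of_multiset X) ! 0 \<in># X" "k \<le> rev (sorted_list_of_multiset X) ! 0"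
proof -
  define xs where "xs = rev (sorted_list_of_multiset X)"
  have "sorted_wrt (\<ge>) xs"
    unfolding xs_def sorted_wrt_rev by (simp add: sorted_sorted_list_of_multiset)
  moreover have "X = mset xs" by (simp add: xs_def)
  ultimately show "rev (sorted_list_of_multiset X) ! 0 \<in># X" "k \<le> rev (sorted_list_of_multiset X) ! 0"
    using assms unfolding xs_def[symmetric] by (cases xs; simp; blast)+
qed

text \<open>Only one copy of the head is removed, so a repeated largest element also counts as
  second.\<close>

lemma second_decreasing_list_of_multiset:
  fixes X :: "'a::linorder multiset"
  assumes "k \<in># X - {#rev (sorted_list_of_multiset X) ! 0#}"
  shows "k \<le> rev (sorted_list_of_multiset X) ! 1"
proof -
  define xs where "xs = rev (sorted_list_of_multiset X)"
  have mset: "mset xs = X" by (simp add: xs_def)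
  have sorted: "sorted_wrt (\<ge>) xs"
    unfolding xs_def sorted_wrt_rev by (simp add: sorted_sorted_list_of_multiset)
  have "X \<noteq> {#}" using assms by auto
  then obtain a ys where xs: "xs = a # ys" using mset by (cases xs) auto
  then have "k \<in> set ys" using assms mset unfolding xs_def[symmetric] by auto
  then show ?thesis
    using sorted xs unfolding xs_def[symmetric] by (cases ys) auto
qed

lemma rayleigh_le_eigval_1:
  fixes A :: "real^'d^'d"
  assumes "transpose A = A"
  shows "y \<bullet> (A *v y) \<le> eigval A 1 * (norm y)\<^sup>2"
proof (cases "y = 0")
  case False
  obtain v l where vl: "norm v = 1" "A *v v = l *\<^sub>R v" "\<And>w. w \<bullet> (A *v w) \<le> l * (norm w)\<^sup>2"
    using rayleigh_max_eigenvector[of "(*v) A" UNIV y] symmetric_matrix_inner[OF assms] False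
    by auto
  have l: "l \<in> spectrum A" using vl(1,2) by (auto simp: spectrum_def intro!: exI[of _ v])
  have "l \<le> eigval A 1"
    unfolding eigval_def diff_self_eq_0
    by (rule hd_decreasing_list_of_multiset(2), subst count_greater_zero_iff[symmetric],
        subst count_eigenvalue_multiset[OF finite_spectrum[OF assms]])
       (use l dim_eigenspace_pos[OF l] in simp)
  then have "l * (norm y)\<^sup>2 \<le> eigval A 1 * (norm y)\<^sup>2" by (intro mult_right_mono) auto
  then show ?thesis using vl(3)[of y] by linarith
qed simp

text \<open>The complement of \<open>v1\<close> is invariant, so the form attains its maximum there
  at an eigenvector. Its eigenvalue still occurs in the spectrum with multiplicities after one copy
  of the largest is taken out.\<close>

lemma rayleigh_le_eigval_2:
  fixes A :: "real^'d^'d"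
  assumes sym: "transpose A = A" and v1: "v1 \<noteq> 0" "A *v v1 = eigval A 1 *\<^sub>R v1" and y: "y \<bullet> v1 = 0"
  shows "y \<bullet> (A *v y) \<le> eigval A 2 * (norm y)\<^sup>2"
proof (cases "y = 0")
  case False
  have inv: "A *v w \<in> {w. v1 \<bullet> w = 0}" if "w \<in> {w. v1 \<bullet> w = 0}" for w
    using that by (simp add: symmetric_matrix_inner[OF sym] v1)
  obtain v l where vl: "v1 \<bullet> v = 0" "norm v = 1" "A *v v = l *\<^sub>R v"
    and ray: "\<And>w. v1 \<bullet> w = 0 \<Longrightarrow> w \<bullet> (A *v w) \<le> l * (norm w)\<^sup>2"
  proof (rule rayleigh_max_eigenvector[of "(*v) A" "{w. v1 \<bullet> w = 0}" y])
    show "y \<in> {w. v1 \<bullet> w = 0}" using y by (simp add: inner_commute)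
  qed (use inv False in \<open>auto simp: subspace_hyperplane symmetric_matrix_inner[OF sym]\<close>)
  have v0: "v \<noteq> 0" using vl(2) by auto
  have spec: "l \<in> spectrum A" "eigval A 1 \<in> spectrum A"
    using vl v1 v0 by (auto simp: spectrum_def)
  let ?X = "\<Sum>l\<in>spectrum A. replicate_mset (dim (eigenspace A l)) l"
  note count = count_eigenvalue_multiset[OF finite_spectrum[OF sym]]
  have "0 < count (?X - {#eigval A 1#}) l"
  \<comment> \<open>If both eigenvalues agree, \<open>v\<close> and \<open>v1\<close> span two
    dimensions of one eigenspace, so a copy survives the removal.\<close>
  proof (cases "l = eigval A 1")
    case True
    have "v \<noteq> v1" using vl v0 by auto
    moreover have "independent {v, v1}"
      using v0 v1 vl by (intro pairwise_orthogonal_independent)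
        (auto simp: pairwise_def orthogonal_def inner_commute)
    ultimately have "2 \<le> dim (eigenspace A l)"
      using independent_card_le_dim[of "{v, v1}" "eigenspace A l"] vl v1 True
      by (simp add: eigenspace_def)
    then show ?thesis using True spec by (simp add: count)
  next
    case False
    then show ?thesis using dim_eigenspace_pos[OF spec(1)] spec(1) by (simp add: count)
  qed
  then have "l \<in># ?X - {#eigval A 1#}" by (simp only: count_greater_zero_iff)
  then have "l \<le> eigval A 2"
    using second_decreasing_list_of_multiset[of l ?X] by (simp add: eigval_def)
  then have "l * (norm y)\<^sup>2 \<le> eigval A 2 * (norm y)\<^sup>2" by (intro mult_right_mono) auto
  then show ?thesis using ray[of y] y by (simp add: inner_commute)
qed simp

lemma gradient_neg_quad_form:
  fixes B :: "real^'d^'d"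
  assumes "transpose B = B"
  shows "gradient (neg_quad_form B) x = - 2 *\<^sub>R (B *v x)"
  unfolding gradient_def
proof (rule the_equality)
  show *: "GDERIV (neg_quad_form B) x :> - 2 *\<^sub>R (B *v x)"
    unfolding gderiv_def neg_quad_form_def[abs_def]
  proof (rule has_derivative_eq_rhs)
    show "((\<lambda>y. - (y \<bullet> (B *v y))) has_derivative (\<lambda>h. - (x \<bullet> (B *v h) + h \<bullet> (B *v x)))) (at x)"
      by (intro has_derivative_minus has_derivative_inner has_derivative_ident
          bounded_linear.has_derivative[OF matrix_vector_mul_bounded_linear])
    show "(\<lambda>h. - (x \<bullet> (B *v h) + h \<bullet> (B *v x))) = (\<lambda>h. h \<bullet> (- 2 *\<^sub>R (B *v x)))"
    proof
      fix h
      have "x \<bullet> (B *v h) = h \<bullet> (B *v x)"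
        by (simp only: symmetric_matrix_inner[OF assms, of x h] inner_commute)
      then show "- (x \<bullet> (B *v h) + h \<bullet> (B *v x)) = h \<bullet> (- 2 *\<^sub>R (B *v x))"
        by simp
    qed
  qed
  fix g assume "GDERIV (neg_quad_form B) x :> g"
  then have "(\<lambda>h. h \<bullet> g) = (\<lambda>h. h \<bullet> (- 2 *\<^sub>R (B *v x)))"
    using * unfolding gderiv_def by (rule has_derivative_unique)
  then show "g = - 2 *\<^sub>R (B *v x)"
    by (metis vector_eq_ldot)
qed

section \<open>Quantization in tangent spaces\<close>

text \<open>The frame carries the error bound isometrically to the tangent space. Its inverse is a
  genuine preimage only for tangent vectors, so tangency has to be assumed of the inputs and
  returned for the output.\<close>

lemma tangent_quant_close:
  assumes Q: "lattice_quantization Q" and frame: "tangent_frame \<phi>" and x: "norm x = 1"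
    and v: "v \<in> tangent_space x" "v' \<in> tangent_space x"
    and le: "norm (v - v') \<le> y" and pos: "0 < y" "0 < w"
  shows "tangent_quant \<phi> Q x v v' y w \<in> tangent_space x"
    and "norm (tangent_quant \<phi> Q x v v' y w - v) \<le> w"
proof -
  have \<phi>: "linear (\<phi> x)" "\<And>u. norm (\<phi> x u) = norm u" "range (\<phi> x) = tangent_space x"
    using frame x by (auto simp: tangent_frame_def)
  have inv: "\<phi> x (inv (\<phi> x) u) = u" if "u \<in> tangent_space x" for u
    using that \<phi>(3) by (intro f_inv_into_f) simp
  have iso: "norm (\<phi> x a - \<phi> x b) = norm (a - b)" for a b
    by (metis linear_diff[OF \<phi>(1)] \<phi>(2))
  show "tangent_quant \<phi> Q x v v' y w \<in> tangent_space x"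
    unfolding tangent_quant_def using \<phi>(3) by blast
  have "norm (inv (\<phi> x) v - inv (\<phi> x) v') \<le> y"
    using le by (subst iso[symmetric]) (simp add: inv v)
  then have "norm (Q (inv (\<phi> x) v) (inv (\<phi> x) v') y w - inv (\<phi> x) v) \<le> w"
    using Q pos unfolding lattice_quantization_def by blast
  then show "norm (tangent_quant \<phi> Q x v v' y w - v) \<le> w"
    unfolding tangent_quant_def by (subst (asm) iso[symmetric]) (simp add: inv v)
qed

section \<open>One exact gradient step\<close>

lemma norm_tangent_proj_le:
  assumes "norm x = 1"
  shows "norm (tangent_proj x z) \<le> norm z"
proof (rule power2_le_imp_le)
  have "(norm (tangent_proj x z))\<^sup>2 = (norm z)\<^sup>2 - (x \<bullet> z)\<^sup>2"
    using inner_self_unit[OF assms] unfolding power2_norm_eq_inner tangent_proj_def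
    by (simp add: inner_diff inner_commute[of z x] power2_eq_square)
  then show "(norm (tangent_proj x z))\<^sup>2 \<le> (norm z)\<^sup>2" by simp
qed simp

lemma tangent_proj_in_tangent_space: "norm x = 1 \<Longrightarrow> tangent_proj x z \<in> tangent_space x"
  by (simp add: tangent_space_def tangent_proj_def inner_diff_right inner_self_unit)

text \<open>Evaluate the nonnegative form at x - t N x; t = 1 / L minimizes the resulting upper
  bound in t.\<close>

lemma selfadjoint_norm_square_bound:
  fixes N :: "'a::real_inner \<Rightarrow> 'a"
  assumes lin: "linear N" and sym: "\<And>y z. y \<bullet> N z = N y \<bullet> z"
    and psd: "\<And>y. 0 \<le> y \<bullet> N y" and bound: "\<And>y. y \<bullet> N y \<le> L * (norm y)\<^sup>2" and L: "0 < L"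
  shows "(norm (N x))\<^sup>2 \<le> L * (x \<bullet> N x)"
proof -
  let ?t = "1 / L"
  have "0 \<le> (x - ?t *\<^sub>R N x) \<bullet> N (x - ?t *\<^sub>R N x)" by (rule psd)
  also have "\<dots> = x \<bullet> N x - 2 * ?t * (norm (N x))\<^sup>2 + ?t * ?t * (N x \<bullet> N (N x))"
    using sym[of x "N x"] unfolding power2_norm_eq_inner
    by (simp add: linear_diff[OF lin] linear_scale[OF lin] inner_diff algebra_simps)
  also have "\<dots> \<le> x \<bullet> N x - 2 * ?t * (norm (N x))\<^sup>2 + ?t * ?t * (L * (norm (N x))\<^sup>2)"
    using bound[of "N x"] L by (intro add_left_mono mult_left_mono) auto
  also have "\<dots> = x \<bullet> N x - (norm (N x))\<^sup>2 / L"
    using L by (simp add: field_simps)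
  finally show ?thesis using L by (simp add: field_simps)
qed

text \<open>By monotonicity sin r / r is at least its value 2 / pi at pi / 2, which exceeds 1 /
  2.\<close>

lemma half_le_sin: "0 \<le> r \<Longrightarrow> r \<le> pi / 2 \<Longrightarrow> r / 2 \<le> sin r"
proof (cases "r = 0")
  case False
  assume "0 \<le> r" "r \<le> pi / 2"
  then have "sin (pi / 2) / (pi / 2) \<le> sin r / r"
    using False by (intro sin_over_decreasing) auto
  moreover have "1 / 2 \<le> 2 / pi" using pi_less_4 by (simp add: field_simps)
  moreover have "sin (pi / 2) / (pi / 2) = 2 / pi" by simp
  ultimately have "1 / 2 \<le> sin r / r" by linarith
  then show ?thesis using False \<open>0 \<le> r\<close> by (simp add: field_simps)
qed simp

text \<open>Comparison of exponentials replaces the new distance by the planar length of - \<eta> g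
  - u, where u is the logarithm of v at x. Its square is at most \<open>r\<^sup>2 - 2 * \<eta> * (l1
  - \<rho>) * (2 * cos r - \<eta> * \<gamma>)\<close>; the step size leaves at least cos D in the
  last factor, and \<open>growth\<close> converts l1 - \<rho> into a multiple of
  \<open>r\<^sup>2\<close>.\<close>

lemma exact_step_contraction:
  fixes B :: "'a::euclidean_space \<Rightarrow> 'a" and v x :: 'a
  assumes lin: "linear B" and sym: "\<And>y z. y \<bullet> B z = B y \<bullet> z" and psd: "\<And>y. 0 \<le> y \<bullet> B y"
    and bound: "\<And>y. y \<bullet> B y \<le> l1 * (norm y)\<^sup>2"
    and gap: "\<And>y. y \<bullet> v = 0 \<Longrightarrow> y \<bullet> B y \<le> l2 * (norm y)\<^sup>2" "l2 \<le> l1"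
    and v: "norm v = 1" "B v = l1 *\<^sub>R v" and x: "norm x = 1"
    and D: "sphere_dist x v \<le> D" "D < pi / 2"
    and \<gamma>: "2 * l1 \<le> \<gamma>" "0 < \<gamma>" and \<eta>: "0 < \<eta>" "\<eta> * \<gamma> \<le> cos D"
    and g: "g = tangent_proj x (- 2 *\<^sub>R B x)"
  shows "(sphere_dist (sphere_exp x (- (\<eta> *\<^sub>R g))) v)\<^sup>2
    \<le> (1 - cos D * ((l1 - l2) / 2) * \<eta>) * (sphere_dist x v)\<^sup>2"
proof -
  define r where "r = sphere_dist x v"
  define \<rho> where "\<rho> = x \<bullet> B x"
  have r: "0 \<le> r" "r \<le> D" "r < pi / 2" "r \<le> pi"
    using sphere_dist_bounds[OF x v(1)] D by (auto simp: r_def)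
  have cosD: "0 \<le> cos D" "cos D \<le> cos r" "cos D \<le> 1"
    using r D by (auto intro!: cos_ge_zero cos_monotone_0_pi_le)
  have \<rho>: "0 \<le> \<rho>" "\<rho> \<le> l1" using psd[of x] bound[of x] x by (auto simp: \<rho>_def)
  obtain u where u: "u \<in> tangent_space x" "sphere_exp x u = v" "norm u = r"
    using sphere_log_exists[OF x v(1)] r
    by (metis r_def pi_gt_zero field_sum_of_halves less_add_same_cancel1 half_gt_zero_iff order_less_trans)
  \<comment> \<open>Weak quasi-convexity: v \<bullet> B x is computed once from the eigenvector
    equation and once from v = cos r x + (sin r / r) u. The factor sin r / r \<le> 1 may be dropped
    only after u \<bullet> B x is known to be nonnegative.\<close>
  have u_dot: "cos r * (l1 - \<rho>) \<le> u \<bullet> B x"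
  proof (cases "r = 0")
    case True
    then have "x = v" using u by (simp add: sphere_exp_def)
    then show ?thesis using True u v by (simp add: \<rho>_def inner_self_unit)
  next
    case False
    define k where "k = sin r / r"
    have k: "0 < k" "k \<le> 1"
      using False r sin_gt_zero[of r] sin_x_le_x[of r] by (auto simp: k_def)
    have "v = cos r *\<^sub>R x + k *\<^sub>R u"
      using u False by (auto simp: sphere_exp_def k_def)
    then have "v \<bullet> B x = cos r * \<rho> + k * (u \<bullet> B x)"
      by (simp add: inner_add_left \<rho>_def)
    moreover have "v \<bullet> B x = l1 * cos r"
      using sym[of v x] v cos_sphere_dist[OF x v(1)] by (simp add: r_def inner_commute)
    ultimately have eq: "k * (u \<bullet> B x) = cos r * (l1 - \<rho>)" by (simp add: algebra_simps)
    have "0 \<le> cos r * (l1 - \<rho>)" using cosD \<rho> by simp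
    then have "0 \<le> u \<bullet> B x" using eq k by (metis zero_le_mult_iff not_less)
    then have "k * (u \<bullet> B x) \<le> u \<bullet> B x" using k by (simp add: mult_left_le_one_le)
    then show ?thesis using eq by simp
  qed
  have g_tan: "g \<in> tangent_space x" unfolding g by (rule tangent_proj_in_tangent_space[OF x])
  have g_u: "g \<bullet> u = - 2 * (u \<bullet> B x)"
    using u by (simp add: g tangent_proj_def tangent_space_def inner_diff inner_commute)
  define N where "N = (\<lambda>y. l1 *\<^sub>R y - B y)"
  have "(norm (N x))\<^sup>2 \<le> \<gamma> / 2 * (x \<bullet> N x)"
  proof (rule selfadjoint_norm_square_bound)
    show "linear N"
      unfolding N_def by (intro linear_compose_sub lin linear_compose_scale_right linear_ident)
    show "y \<bullet> N z = N y \<bullet> z" for y z by (simp add: N_def inner_diff sym)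
    show "0 \<le> y \<bullet> N y" for y using bound[of y] by (simp add: N_def inner_diff_right dot_square_norm)
    show "y \<bullet> N y \<le> \<gamma> / 2 * (norm y)\<^sup>2" for y
    proof -
      have "l1 * (norm y)\<^sup>2 \<le> \<gamma> / 2 * (norm y)\<^sup>2" using \<gamma> by (intro mult_right_mono) auto
      then show ?thesis using psd[of y] by (simp add: N_def inner_diff_right dot_square_norm)
    qed
  qed (use \<gamma> in simp)
  \<comment> \<open>N x and - B x differ by a multiple of x, which the projection removes;
    \<open>N\<close> is positive semidefinite with x \<bullet> N x = f - f*.\<close>
  moreover have "g = tangent_proj x (2 *\<^sub>R N x)"
    using inner_self_unit[OF x] by (simp add: g tangent_proj_def N_def inner_diff_right algebra_simps)
  then have "norm g \<le> 2 * norm (N x)" using norm_tangent_proj_le[OF x, of "2 *\<^sub>R N x"] by simp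
  then have "(norm g)\<^sup>2 \<le> 4 * (norm (N x))\<^sup>2"
    using power_mono[of "norm g" "2 * norm (N x)" 2] by (simp add: power_mult_distrib)
  moreover have "x \<bullet> N x = l1 - \<rho>"
    using inner_self_unit[OF x] by (simp add: N_def inner_diff_right \<rho>_def)
  ultimately have g_sq: "(norm g)\<^sup>2 \<le> 2 * \<gamma> * (l1 - \<rho>)" by simp
  have "norm g \<le> \<gamma>"
  proof (rule power2_le_imp_le)
    have "2 * \<gamma> * (l1 - \<rho>) \<le> 2 * \<gamma> * (\<gamma> / 2)" using \<gamma> \<rho> by (intro mult_left_mono) auto
    then show "(norm g)\<^sup>2 \<le> \<gamma>\<^sup>2" using g_sq by (simp add: power2_eq_square)
  qed (use \<gamma> in simp)
  then have "norm (- (\<eta> *\<^sub>R g)) \<le> \<eta> * \<gamma>" using \<eta> by simp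
  \<comment> \<open>With r < pi / 2 this keeps the two tangent lengths below pi in total, as the
    comparison of exponentials requires.\<close>
  then have small: "norm (- (\<eta> *\<^sub>R g)) \<le> 1" using \<eta> cosD by linarith
  have growth: "(l1 - l2) * (r\<^sup>2 / 4) \<le> l1 - \<rho>"
  proof -
    define w where "w = x - (x \<bullet> v) *\<^sub>R v"
    have w: "w \<bullet> v = 0" using inner_self_unit[OF v(1)] by (simp add: w_def inner_diff_left)
    have "norm w = sin r" using norm_perp_part_sphere[OF x v(1)] by (simp add: w_def r_def)
    have "x = cos r *\<^sub>R v + w" using cos_sphere_dist[OF x v(1)] by (simp add: w_def r_def)
    then have "\<rho> = (cos r *\<^sub>R v + w) \<bullet> B (cos r *\<^sub>R v + w)" unfolding \<rho>_def by simp
    also have "\<dots> = (cos r)\<^sup>2 * l1 + w \<bullet> B w"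
      using w sym[of v w] inner_self_unit[OF v(1)]
      by (simp add: linear_add[OF lin] linear_scale[OF lin] v inner_add inner_commute[of v w] power2_eq_square)
    also have "\<dots> \<le> (1 - (sin r)\<^sup>2) * l1 + l2 * (sin r)\<^sup>2"
      using gap(1)[OF w] \<open>norm w = sin r\<close> by (simp add: cos_squared_eq)
    finally have "(l1 - l2) * (sin r)\<^sup>2 \<le> l1 - \<rho>" by (simp add: algebra_simps)
    moreover have "(r / 2)\<^sup>2 \<le> (sin r)\<^sup>2" using half_le_sin[of r] r by (intro power_mono) auto
    then have "(l1 - l2) * (r / 2)\<^sup>2 \<le> (l1 - l2) * (sin r)\<^sup>2" using gap by (intro mult_left_mono) auto
    ultimately show ?thesis by (simp add: power_divide)
  qed
  have "sphere_dist (sphere_exp x (- (\<eta> *\<^sub>R g))) (sphere_exp x u) \<le> norm (- (\<eta> *\<^sub>R g) - u)"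
    using small r u g_tan pi_gt3
    by (intro sphere_dist_exp_exp_le x u(1)) (auto simp: tangent_space_def)
  then have "(sphere_dist (sphere_exp x (- (\<eta> *\<^sub>R g))) v)\<^sup>2 \<le> (norm (- (\<eta> *\<^sub>R g) - u))\<^sup>2"
    using g_tan u v x by (intro power_mono) (auto simp: sphere_dist_bounds norm_sphere_exp tangent_space_def)
  also have "\<dots> = r\<^sup>2 + 2 * \<eta> * (g \<bullet> u) + \<eta>\<^sup>2 * (norm g)\<^sup>2"
    unfolding u(3)[symmetric] power2_norm_eq_inner
    by (simp add: inner_diff inner_commute[of u g] power2_eq_square algebra_simps)
  also have "\<dots> \<le> r\<^sup>2 - 4 * \<eta> * (cos r * (l1 - \<rho>)) + \<eta>\<^sup>2 * (2 * \<gamma> * (l1 - \<rho>))"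
  proof -
    have "4 * \<eta> * (cos r * (l1 - \<rho>)) \<le> 4 * \<eta> * (u \<bullet> B x)"
      using u_dot \<eta> by (intro mult_left_mono) auto
    moreover have "\<eta>\<^sup>2 * (norm g)\<^sup>2 \<le> \<eta>\<^sup>2 * (2 * \<gamma> * (l1 - \<rho>))"
      using g_sq by (intro mult_left_mono) auto
    moreover have "2 * \<eta> * (g \<bullet> u) = - (4 * \<eta> * (u \<bullet> B x))"
      by (simp add: g_u)
    ultimately show ?thesis by linarith
  qed
  also have "\<dots> = r\<^sup>2 - 2 * \<eta> * (l1 - \<rho>) * (2 * cos r - \<eta> * \<gamma>)"
    by (simp add: algebra_simps power2_eq_square)
  also have "\<dots> \<le> r\<^sup>2 - 2 * \<eta> * (l1 - \<rho>) * cos D"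
    using \<eta> cosD \<rho> by (intro diff_left_mono mult_left_mono) auto
  also have "\<dots> \<le> r\<^sup>2 - 2 * \<eta> * ((l1 - l2) * (r\<^sup>2 / 4)) * cos D"
    using growth \<eta> cosD by (intro diff_left_mono mult_left_mono mult_right_mono) auto
  also have "\<dots> = (1 - cos D * ((l1 - l2) / 2) * \<eta>) * r\<^sup>2"
    by (simp add: field_simps)
  finally show ?thesis unfolding r_def .
qed

section \<open>Gram matrices of the data blocks\<close>

lemma local_gram_mult_vec:
  "local_gram M own i *v y = (\<Sum>r | own r = i. (M $ r \<bullet> y) *\<^sub>R M $ r)"
  by (simp add: vec_eq_iff local_gram_def matrix_vector_mult_def inner_vec_def sum_distrib_left
      sum_distrib_right sum.swap[where B = "{r. own r = i}"] mult_ac)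

lemma gram_mult_vec: "(transpose M ** M) *v y = (\<Sum>r\<in>UNIV. (M $ r \<bullet> y) *\<^sub>R M $ r)"
  for M :: "real^'d^'m"
  by (simp add: vec_eq_iff matrix_matrix_mult_def transpose_def matrix_vector_mult_def inner_vec_def
      sum_distrib_left sum_distrib_right sum.swap[where B = "UNIV :: 'm set"] mult_ac)

text \<open>The rank-one contributions of the rows are regrouped by owner; a machine without rows
  contributes the zero matrix.\<close>

lemma gram_eq_sum_local_gram:
  fixes own :: "'m::finite \<Rightarrow> 'n::finite"
  shows "(transpose M ** M) *v y = (\<Sum>i\<in>UNIV. local_gram M own i *v y)"
  unfolding gram_mult_vec local_gram_mult_vec
  using sum.group[of UNIV UNIV own "\<lambda>r. (M $ r \<bullet> y) *\<^sub>R M $ r"] by simp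

lemma transpose_local_gram: "transpose (local_gram M own i) = local_gram M own i"
  by (simp add: vec_eq_iff transpose_def local_gram_def mult.commute)

lemma local_gram_psd: "0 \<le> y \<bullet> (local_gram M own i *v y)"
  by (simp add: local_gram_mult_vec inner_sum_right inner_commute[of y] sum_nonneg)

theorem lemma8:
  fixes M :: "real^'d^'m"
    and own :: "'m \<Rightarrow> 'n::finite"
    and A :: "real^'d^'d"
    and Ai :: "'n \<Rightarrow> real^'d^'d"
    and f :: "real^'d \<Rightarrow> real"
    and fi :: "'n \<Rightarrow> real^'d \<Rightarrow> real"
    and \<delta> \<mu> \<gamma> \<eta> D \<sigma> K \<theta> \<xi> :: real
    and R :: "nat \<Rightarrow> real"
    and x0 v1 xstar :: "real^'d"
    and \<phi> :: "real^'d \<Rightarrow> real^'k \<Rightarrow> real^'d"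
    and Q :: "real^'k \<Rightarrow> real^'k \<Rightarrow> real \<Rightarrow> real \<Rightarrow> real^'k"
    and i0 j :: 'n
    and x :: "nat \<Rightarrow> real^'d"
    and qs :: "nat \<Rightarrow> 'n \<Rightarrow> real^'d"
    and q :: "nat \<Rightarrow> real^'d"
  assumes dims: "CARD('d) = CARD('k) + 1"
    and A: "A = transpose M ** M"
    and Ai: "\<And>i. Ai i = local_gram M own i"
    and f: "f = neg_quad_form A"
    and fi: "\<And>i. fi i = neg_quad_form (Ai i)"
    and delta: "\<delta> = eigval A 1 - eigval A 2" "\<delta> > 0"
    and mu: "\<mu> = \<delta> / 2"
    and gamma: "\<gamma> = real CARD('n) * Max (range (\<lambda>i. 2 * lambda_max (Ai i)))"
    and x0: "x0 \<in> sphere 0 1"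
    and v1: "v1 \<in> sphere 0 1" "A *v v1 = eigval A 1 *\<^sub>R v1"
    and xstar: "is_arg_min (sphere_dist x0) (\<lambda>z. z \<in> {v1, - v1}) xstar"
    and D: "0 < D" "D < pi / 2" "sphere_dist x0 xstar \<le> D"
    and sigma: "\<sigma> = (if cos D * \<mu> * \<eta> \<le> 1 / 2 then 1 - cos D * \<mu> * \<eta> else 1 / 2)"
    and K: "K = 2 / sqrt \<sigma>"
    and theta: "\<theta> = sqrt \<sigma> * (1 - sqrt \<sigma>) / 4"
    and xi: "sqrt \<xi> = \<theta> * K + sqrt \<sigma>"
    and R: "\<And>t. R t = \<gamma> * K * sqrt \<xi> ^ t * D"
    and Q: "lattice_quantization Q"
    and frame: "tangent_frame \<phi>"
    and run: "quantized_rgd (tangent_quant \<phi> Q) (\<lambda>i. sphere_grad (fi i)) i0 j \<eta> \<gamma> \<theta> R x0 x qs q"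
    and eta: "0 < \<eta>" "\<eta> \<le> cos D / \<gamma>"
  shows "\<forall>t i. (sphere_dist (x t) xstar)\<^sup>2 \<le> \<xi> ^ t * D\<^sup>2 \<and>
           norm (qs t i - sphere_grad (fi i) (x t)) \<le> \<theta> * R t / (2 * real CARD('n)) \<and>
           norm (q t - sphere_grad f (x t)) \<le> \<theta> * R t"
proof -
  let ?n = "real CARD('n)"
  define s where "s = sqrt \<sigma>"
  define \<rho> where "\<rho> = sqrt \<xi>"
  define G where "G = (\<lambda>i. sphere_grad (fi i))"
  define Gf where "Gf = sphere_grad f"
  define l1 l2 where "l1 = eigval A 1" and "l2 = eigval A 2"

  have npos: "0 < ?n" by (simp add: zero_less_card_finite)
  have cosD: "0 < cos D" "cos D \<le> 1" using D by (auto intro: cos_gt_zero)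
  \<comment> \<open>Forced by the step size condition: for \<gamma> \<le> 0 the quotient is at most
    0, including \<gamma> = 0, where division yields 0.\<close>
  have \<gamma>: "0 < \<gamma>"
  proof (rule ccontr)
    assume "\<not> 0 < \<gamma>"
    then have "cos D / \<gamma> \<le> 0" using cosD by (simp add: divide_nonneg_nonpos)
    then show False using eta by simp
  qed
  have \<eta>\<gamma>: "\<eta> * \<gamma> \<le> cos D" using eta \<gamma> by (simp add: field_simps)
  then have \<eta>\<gamma>_1: "\<eta> * \<gamma> \<le> 1" using cosD by linarith

  \<comment> \<open>Spectral bounds for \<open>A\<close> and its blocks\<close>
  have sym_i: "transpose (Ai i) = Ai i" for i by (simp add: Ai transpose_local_gram)
  have sym: "transpose A = A" by (simp add: A matrix_transpose_mul)
  have A_sum: "A *v y = (\<Sum>i\<in>UNIV. Ai i *v y)" for y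
    unfolding A Ai by (rule gram_eq_sum_local_gram)
  have psd_i: "0 \<le> y \<bullet> (Ai i *v y)" for i y by (simp add: Ai local_gram_psd)
  have psd: "0 \<le> y \<bullet> (A *v y)" for y by (simp add: A_sum inner_sum_right psd_i sum_nonneg)
  have ray_i: "y \<bullet> (Ai i *v y) \<le> \<gamma> / (2 * ?n) * (norm y)\<^sup>2" for i y
  proof -
    have "2 * lambda_max (Ai i) \<le> Max (range (\<lambda>i. 2 * lambda_max (Ai i)))" by (intro Max_ge) auto
    also have "\<dots> = \<gamma> / ?n" using npos by (simp add: gamma)
    finally have "lambda_max (Ai i) \<le> \<gamma> / (2 * ?n)" by simp
    then have "lambda_max (Ai i) * (norm y)\<^sup>2 \<le> \<gamma> / (2 * ?n) * (norm y)\<^sup>2"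
      by (intro mult_right_mono) auto
    then show ?thesis using rayleigh_le_lambda_max[OF sym_i, of y i] by linarith
  qed
  have ray: "y \<bullet> (A *v y) \<le> \<gamma> / 2 * (norm y)\<^sup>2" for y
  proof -
    have "y \<bullet> (A *v y) \<le> (\<Sum>i\<in>(UNIV::'n set). \<gamma> / (2 * ?n) * (norm y)\<^sup>2)"
      unfolding A_sum inner_sum_right by (intro sum_mono ray_i)
    then show ?thesis using npos by simp
  qed
  have l1_le: "2 * l1 \<le> \<gamma>"
    using ray[of v1] v1 by (simp add: l1_def inner_self_unit)

  \<comment> \<open>Gradients: tangency, size and Lipschitz constants\<close>
  have G_eq: "G i y = tangent_proj y (- 2 *\<^sub>R (Ai i *v y))" for i y
    by (simp only: G_def fi sphere_grad_def gradient_neg_quad_form[OF sym_i])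
  have Gf_eq: "Gf y = tangent_proj y (- 2 *\<^sub>R (A *v y))" for y
    by (simp only: Gf_def f sphere_grad_def gradient_neg_quad_form[OF sym])
  have Gf_sum: "Gf y = (\<Sum>i\<in>UNIV. G i y)" for y
    unfolding Gf_eq G_eq A_sum
    by (simp add: tangent_proj_def sum_subtractf inner_sum_right scaleR_sum_left scaleR_sum_right
        sum_negf sum_distrib_left)
  have G_tan: "G i y \<in> tangent_space y" and Gf_tan: "Gf y \<in> tangent_space y" if "norm y = 1" for i y
    using that by (simp_all only: G_eq Gf_eq tangent_proj_in_tangent_space)
  have grad_bound: "norm (tangent_proj y (- 2 *\<^sub>R (B *v y))) \<le> 2 * L"
    if "transpose B = B" "\<And>y. 0 \<le> y \<bullet> (B *v y)" "\<And>y. y \<bullet> (B *v y) \<le> L * (norm y)\<^sup>2" "norm y = 1"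
    for B :: "real^'d^'d" and L y
  proof -
    have "norm (B *v y) \<le> L * norm y"
    proof (rule selfadjoint_norm_bound)
      show "z \<bullet> (B *v w) = (B *v z) \<bullet> w" for z w by (rule symmetric_matrix_inner[OF that(1)])
      show "\<bar>z \<bullet> (B *v z)\<bar> \<le> L * (norm z)\<^sup>2" for z using that(2,3)[of z] by simp
    qed simp
    then show ?thesis
      using norm_tangent_proj_le[OF that(4), of "- 2 *\<^sub>R (B *v y)"] that(4) by simp
  qed
  have G_bound: "norm (G i y) \<le> \<gamma> / ?n" if "norm y = 1" for i y
    using grad_bound[OF sym_i psd_i ray_i that] by (simp add: G_eq)
  have Gf_bound: "norm (Gf y) \<le> \<gamma>" if "norm y = 1" for y
    using grad_bound[OF sym psd ray that] by (simp add: Gf_eq)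
  have G_lip: "norm (parallel_transport p q (G i p) - G i q) \<le> \<gamma> / ?n * sphere_dist p q"
    if "norm p = 1" "norm q = 1" "sphere_dist p q < pi" for i p q
    using parallel_transport_grad_lipschitz[OF _ symmetric_matrix_inner[OF sym_i] psd_i ray_i that]
    by (simp add: G_eq)
  have Gf_lip: "norm (parallel_transport p q (Gf p) - Gf q) \<le> \<gamma> * sphere_dist p q"
    if "norm p = 1" "norm q = 1" "sphere_dist p q < pi" for p q
    using parallel_transport_grad_lipschitz[OF _ symmetric_matrix_inner[OF sym] psd ray that]
    by (simp add: Gf_eq)

  have "0 < cos D * \<mu> * \<eta>" using cosD eta delta mu by simp
  \<comment> \<open>Capping at 1 / 2 only enlarges the contraction factor, and it keeps \<sigma>
    positive so that \<open>K\<close> makes sense.\<close>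
  then have \<sigma>: "1 / 2 \<le> \<sigma>" "\<sigma> < 1" "1 - cos D * \<mu> * \<eta> \<le> \<sigma>"
    using sigma by (auto split: if_splits)
  then have s: "0 < s" "s < 1" and s2: "s\<^sup>2 = \<sigma>" by (auto simp: s_def)
  have Ks: "K = 2 / s" and \<theta>s: "\<theta> = s * (1 - s) / 4" using K theta by (simp_all add: s_def)
  have \<theta>K: "\<theta> * K = (1 - s) / 2" using s by (simp add: Ks \<theta>s field_simps)
  have Kpos: "2 < K" and \<theta>: "0 < \<theta>" using s by (simp_all add: Ks \<theta>s field_simps)
  have \<theta>_le: "\<theta> \<le> \<theta> * K" using Kpos \<theta> by simp
  have \<rho>_eq: "\<rho> = \<theta> * K + s" using xi by (simp add: \<rho>_def s_def)
  have \<rho>: "0 < \<rho>" "\<rho> < 1" using s by (simp_all only: \<rho>_eq \<theta>K) (simp_all add: field_simps)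
  \<comment> \<open>\<open>sqrt\<close> is negative on negative reals, so \<rho> > 0 rules out a
    negative \<xi>.\<close>
  have \<xi>: "\<xi> = \<rho>\<^sup>2" using \<rho>(1) by (simp add: \<rho>_def)
  have R_eq: "R t = \<gamma> * K * \<rho> ^ t * D" for t by (simp add: R \<rho>_def)
  have Rpos: "0 < R t" for t using \<gamma> Kpos \<rho> D by (simp add: R_eq)
  have R_Suc: "R (Suc t) = \<rho> * R t" for t by (simp add: R_eq)
  \<comment> \<open>Here the 2 in K = 2 / s matches the bound on the distance of consecutive
    iterates.\<close>
  have R_dist: "\<gamma> * (2 * (\<rho> ^ t * D)) = s * R t" for t using s by (simp add: R_eq Ks)
  have \<theta>R: "\<eta> * (\<theta> * R t) \<le> \<theta> * K * (\<rho> ^ t * D)" for t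
  proof -
    have "\<eta> * (\<theta> * R t) = \<eta> * \<gamma> * (\<theta> * K * (\<rho> ^ t * D))" by (simp add: R_eq)
    also have "\<dots> \<le> 1 * (\<theta> * K * (\<rho> ^ t * D))"
      using \<eta>\<gamma>_1 \<theta> Kpos \<rho> D by (intro mult_right_mono) auto
    finally show ?thesis by simp
  qed

  \<comment> \<open>Contraction of the exact step towards \<open>xstar\<close>\<close>
  have star: "norm xstar = 1" "A *v xstar = l1 *\<^sub>R xstar"
  proof -
    have "xstar = v1 \<or> xstar = - v1" using xstar by (auto simp: is_arg_min_def)
    then show "norm xstar = 1" "A *v xstar = l1 *\<^sub>R xstar"
      using v1 by (auto simp: l1_def linear_neg[OF matrix_vector_mul_linear])
  qed
  have gap: "y \<bullet> (A *v y) \<le> l2 * (norm y)\<^sup>2" if "y \<bullet> xstar = 0" for y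
    unfolding l2_def using star that
    by (intro rayleigh_le_eigval_2[OF sym, of xstar]) (auto simp: l1_def)
  have contract: "sphere_dist (sphere_exp y (- (\<eta> *\<^sub>R Gf y))) xstar \<le> s * sphere_dist y xstar"
    if y: "norm y = 1" "sphere_dist y xstar \<le> D" for y
  proof (rule power2_le_imp_le)
    have "(sphere_dist (sphere_exp y (- (\<eta> *\<^sub>R Gf y))) xstar)\<^sup>2
        \<le> (1 - cos D * ((l1 - l2) / 2) * \<eta>) * (sphere_dist y xstar)\<^sup>2"
      by (rule exact_step_contraction[where B = "(*v) A" and \<gamma> = \<gamma>])
        (use symmetric_matrix_inner[OF sym] psd rayleigh_le_eigval_1[OF sym] gap star y D l1_le \<gamma>
          eta \<eta>\<gamma> delta Gf_eq in \<open>simp_all add: l1_def l2_def\<close>)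
    also have "\<dots> \<le> \<sigma> * (sphere_dist y xstar)\<^sup>2"
      using \<sigma>(3) by (intro mult_right_mono) (simp_all add: l1_def l2_def mu delta)
    finally show "(sphere_dist (sphere_exp y (- (\<eta> *\<^sub>R Gf y))) xstar)\<^sup>2 \<le> (s * sphere_dist y xstar)\<^sup>2"
      by (simp add: power_mult_distrib s2)
    show "0 \<le> s * sphere_dist y xstar" using s y star by (simp add: sphere_dist_bounds)
  qed

  \<comment> \<open>From local gradients to the decoded sum\<close>
  note quant = tangent_quant_close[OF Q frame]
  \<comment> \<open>The \<open>n\<close> local errors consume half of the budget \<theta> R(t);
    quantizing the sum consumes the other half.\<close>
  have sum_err: "norm ((\<Sum>i\<in>UNIV. c i) - Gf y) \<le> e / 2"
    if "\<And>i. norm (c i - G i y) \<le> e / (2 * ?n)" for c y e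
  proof -
    have "norm (\<Sum>i\<in>UNIV. c i - G i y) \<le> (\<Sum>i\<in>(UNIV::'n set). e / (2 * ?n))"
      by (intro sum_norm_le that)
    then show ?thesis using npos by (simp add: Gf_sum sum_subtractf)
  qed
  have sum_tan: "(\<Sum>i\<in>(UNIV::'n set). c i) \<in> tangent_space y" if "\<And>i. c i \<in> tangent_space y" for c y
    using that by (simp add: tangent_space_def inner_sum_right)

  \<comment> \<open>The induction carries unit norms and tangency along with the claims, since the
    quantizer, the exponential map and the transport need them.\<close>
  have round: "norm (x t) = 1 \<and> sphere_dist (x t) xstar \<le> \<rho> ^ t * D \<and>
      (\<forall>i. qs t i \<in> tangent_space (x t) \<and> norm (qs t i - G i (x t)) \<le> \<theta> * R t / (2 * ?n)) \<and>
      q t \<in> tangent_space (x t) \<and> norm (q t - Gf (x t)) \<le> \<theta> * R t" for t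
  proof (induction t)
    case 0
    have x_0: "x 0 = x0" and
      qs_0: "\<And>i. qs 0 i = tangent_quant \<phi> Q x0 (G i x0) (G i0 x0) (2 * \<gamma> * pi) (\<theta> * R 0 / (2 * ?n))" and
      q_0: "q 0 = tangent_quant \<phi> Q x0 (\<Sum>i\<in>UNIV. qs 0 i) (G j x0) (\<theta> * R 0 / 2 + 2 * \<gamma> * pi) (\<theta> * R 0 / 2)"
      using run by (simp_all add: quantized_rgd_def G_def)
    have nx: "norm x0 = 1" using x0 by simp
    have "\<gamma> / ?n \<le> \<gamma>" using \<gamma> npos by (simp add: field_simps)
    then have G_le: "norm (G i x0) \<le> \<gamma>" for i using G_bound[OF nx, of i] by linarith
    have \<gamma>_pi: "2 * \<gamma> \<le> 2 * \<gamma> * pi" using \<gamma> pi_ge_two by simp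
    \<comment> \<open>There is no earlier vector to compare with, but all local gradients have norm
      at most \<gamma>, so any two are 2 \<gamma> close.\<close>
    have close: "norm (G i x0 - G i0 x0) \<le> 2 * \<gamma> * pi" for i
      using norm_triangle_ineq4[of "G i x0" "G i0 x0"] G_le[of i] G_le[of i0] \<gamma>_pi by linarith
    have qs_tan: "qs 0 i \<in> tangent_space x0" and
      qs_err: "norm (qs 0 i - G i x0) \<le> \<theta> * R 0 / (2 * ?n)" for i
      unfolding qs_0 using close[of i] \<gamma> \<theta> Rpos[of 0] npos
      by (auto intro!: quant nx G_tan)
    note r_tan = sum_tan[of "qs 0", OF qs_tan]
    note r_err = sum_err[of "qs 0" x0 "\<theta> * R 0", OF qs_err]
    have r_close: "norm ((\<Sum>i\<in>UNIV. qs 0 i) - G j x0) \<le> \<theta> * R 0 / 2 + 2 * \<gamma> * pi"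
      using r_err norm_triangle_ineq[of "(\<Sum>i\<in>UNIV. qs 0 i) - Gf x0" "Gf x0 - G j x0"]
        norm_triangle_ineq4[of "Gf x0" "G j x0"] Gf_bound[OF nx] G_le[of j] \<gamma>_pi
      by simp
    have pos: "0 < \<theta> * R 0 / 2 + 2 * \<gamma> * pi" "0 < \<theta> * R 0 / 2"
      using \<gamma> \<theta> Rpos[of 0] by (simp_all add: add_pos_pos)
    have "q 0 \<in> tangent_space x0" "norm (q 0 - (\<Sum>i\<in>UNIV. qs 0 i)) \<le> \<theta> * R 0 / 2"
      unfolding q_0 by (rule quant[OF nx r_tan G_tan[OF nx] r_close pos])+
    moreover from this have "norm (q 0 - Gf x0) \<le> \<theta> * R 0"
      using r_err norm_triangle_ineq[of "q 0 - (\<Sum>i\<in>UNIV. qs 0 i)" "(\<Sum>i\<in>UNIV. qs 0 i) - Gf x0"]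
      by simp
    ultimately show ?case using nx qs_tan qs_err D(3) by (simp add: x_0)
  next
    case (Suc t)
    let ?x = "x t" and ?y = "x (Suc t)" and ?d = "\<rho> ^ t * D"
    define \<Gamma> where "\<Gamma> = parallel_transport ?x ?y"
    have y: "?y = sphere_exp ?x (- (\<eta> *\<^sub>R q t))" and
      qs_Suc: "\<And>i. qs (Suc t) i = tangent_quant \<phi> Q ?y (G i ?y) (\<Gamma> (qs t i))
        (R (Suc t) / ?n) (\<theta> * R (Suc t) / (2 * ?n))" and
      q_Suc: "q (Suc t) = tangent_quant \<phi> Q ?y (\<Sum>i\<in>UNIV. qs (Suc t) i) (\<Gamma> (q t))
        ((1 + \<theta> / 2) * R (Suc t)) (\<theta> * R (Suc t) / 2)"
      using run by (simp_all add: quantized_rgd_def G_def \<Gamma>_def)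
    have nx: "norm ?x = 1" and dist_x: "sphere_dist ?x xstar \<le> ?d"
      and qs_tan: "\<And>i. qs t i \<in> tangent_space ?x"
      and qs_err: "\<And>i. norm (qs t i - G i ?x) \<le> \<theta> * R t / (2 * ?n)"
      and q_tan: "q t \<in> tangent_space ?x" and q_err: "norm (q t - Gf ?x) \<le> \<theta> * R t"
      using Suc by auto
    have d: "0 < ?d" "?d \<le> D" using D \<rho> by (auto intro!: mult_left_le_one_le power_le_one)
    have step_tan: "- (\<eta> *\<^sub>R q t) \<in> tangent_space ?x" "- (\<eta> *\<^sub>R Gf ?x) \<in> tangent_space ?x"
      using q_tan Gf_tan[OF nx] by (simp_all add: tangent_space_def)
    have ny: "norm ?y = 1" unfolding y by (rule norm_sphere_exp[OF nx step_tan(1)])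

    have dist_y: "sphere_dist ?y xstar \<le> \<rho> * ?d"
    proof -
      let ?z = "sphere_exp ?x (- (\<eta> *\<^sub>R Gf ?x))"
      have nz: "norm ?z = 1" by (rule norm_sphere_exp[OF nx step_tan(2)])
      have "\<eta> * norm (q t - Gf ?x) \<le> \<eta> * (\<theta> * R t)"
        using q_err eta by (intro mult_left_mono) auto
      then have err: "\<eta> * norm (q t - Gf ?x) \<le> \<theta> * K * ?d" using \<theta>R[of t] by linarith
      have "\<eta> * norm (Gf ?x) \<le> \<eta> * \<gamma>" using Gf_bound[OF nx] eta by (intro mult_left_mono) auto
      then have gf1: "\<eta> * norm (Gf ?x) \<le> 1" using \<eta>\<gamma>_1 by linarith
      have "norm (q t) \<le> norm (q t - Gf ?x) + norm (Gf ?x)" 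
        using norm_triangle_ineq[of "q t - Gf ?x" "Gf ?x"] by simp
      then have "\<eta> * norm (q t) \<le> \<eta> * (norm (q t - Gf ?x) + norm (Gf ?x))"
        using eta by (intro mult_left_mono) auto
      then have "\<eta> * norm (q t) \<le> \<theta> * K * ?d + 1"
        using err gf1 by (simp add: distrib_left)
      \<comment> \<open>Then the quantized and the exact step together are shorter than pi / 4 + 2 <
        pi, and the comparison of exponentials applies.\<close>
      moreover have "\<theta> * K * ?d \<le> 1 / 2 * D"
        using d s \<theta>K by (intro mult_mono) auto
      ultimately have "\<eta> * norm (q t) + \<eta> * norm (Gf ?x) \<le> pi"
        using gf1 D(2) pi_gt3 by linarith
      then have "norm (- (\<eta> *\<^sub>R q t)) + norm (- (\<eta> *\<^sub>R Gf ?x)) \<le> pi"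
        using eta by simp
      then have "sphere_dist ?y ?z \<le> norm (- (\<eta> *\<^sub>R q t) - - (\<eta> *\<^sub>R Gf ?x))"
        unfolding y by (rule sphere_dist_exp_exp_le[OF nx step_tan])
      also have "\<dots> = \<eta> * norm (q t - Gf ?x)"
      proof -
        have "- (\<eta> *\<^sub>R q t) - - (\<eta> *\<^sub>R Gf ?x) = - (\<eta> *\<^sub>R (q t - Gf ?x))"
          by (simp add: scaleR_diff_right)
        then show ?thesis using eta by (simp del: minus_diff_eq)
      qed
      finally have "sphere_dist ?y ?z \<le> \<theta> * K * ?d" using err by linarith
      moreover have "sphere_dist ?z xstar \<le> s * sphere_dist ?x xstar"
        using dist_x d by (intro contract nx) linarith
      moreover have "s * sphere_dist ?x xstar \<le> s * ?d" using dist_x s by (intro mult_left_mono) auto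
      ultimately have "sphere_dist ?y xstar \<le> \<theta> * K * ?d + s * ?d"
        using sphere_dist_triangle[OF ny nz star(1)] by linarith
      then show ?thesis by (simp add: \<rho>_eq distrib_right)
    qed

    have "\<rho> * ?d \<le> 1 * ?d" using \<rho> d by (intro mult_right_mono) auto
    then have dist_xy: "sphere_dist ?x ?y \<le> 2 * ?d"
      using sphere_dist_triangle[OF nx star(1) ny] dist_x dist_y
      by (simp add: sphere_dist_commute[of xstar])
    \<comment> \<open>This uses D < pi / 2 and makes the transport well defined.\<close>
    then have lt: "sphere_dist ?x ?y < pi" using d D by linarith
    have \<gamma>_dist: "\<gamma> * sphere_dist ?x ?y \<le> s * R t"
      unfolding R_dist[symmetric] using dist_xy \<gamma> by (intro mult_left_mono) auto
    \<comment> \<open>Lipschitz drift s and old error \<theta> fit because \<theta> \<le> \<theta>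
      K.\<close>
    have budget: "(\<theta> + s) * R t \<le> R (Suc t)"
      unfolding R_Suc \<rho>_eq using \<theta>_le Rpos[of t] by (intro mult_right_mono) auto
    have \<Gamma>_tan: "\<Gamma> v \<in> tangent_space ?y" if "v \<in> tangent_space ?x" for v
      unfolding \<Gamma>_def by (rule parallel_transport_tangent[OF nx ny lt that])
    have \<Gamma>_iso: "norm (\<Gamma> v - \<Gamma> w) = norm (v - w)" if "v \<in> tangent_space ?x" "w \<in> tangent_space ?x" for v w
      unfolding \<Gamma>_def by (rule norm_parallel_transport_diff[OF nx ny lt that])

    have close: "norm (G i ?y - \<Gamma> (qs t i)) \<le> R (Suc t) / ?n" for i
    proof -
      have "norm (G i ?y - \<Gamma> (qs t i)) \<le> norm (\<Gamma> (G i ?x) - G i ?y) + norm (\<Gamma> (qs t i) - \<Gamma> (G i ?x))"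
        using norm_triangle_ineq[of "G i ?y - \<Gamma> (G i ?x)" "\<Gamma> (G i ?x) - \<Gamma> (qs t i)"]
        by (simp add: norm_minus_commute)
      also have "\<dots> \<le> \<gamma> / ?n * sphere_dist ?x ?y + \<theta> * R t / (2 * ?n)"
        using G_lip[OF nx ny lt, of i] qs_err[of i] \<Gamma>_iso[OF qs_tan G_tan[OF nx], of i i]
        by (simp add: \<Gamma>_def)
      also have "\<dots> = (\<gamma> * sphere_dist ?x ?y + \<theta> * R t / 2) / ?n"
        using npos by (simp add: field_simps)
      also have "\<dots> \<le> R (Suc t) / ?n"
      proof (intro divide_right_mono)
        have "0 \<le> \<theta> * R t" using \<theta> Rpos[of t] by simp
        then show "\<gamma> * sphere_dist ?x ?y + \<theta> * R t / 2 \<le> R (Suc t)"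
          using \<gamma>_dist budget by (simp add: distrib_right)
      qed simp
      finally show ?thesis .
    qed
    have qs_tan': "qs (Suc t) i \<in> tangent_space ?y" and
      qs_err': "norm (qs (Suc t) i - G i ?y) \<le> \<theta> * R (Suc t) / (2 * ?n)" for i
      unfolding qs_Suc using close[of i] \<theta> Rpos[of "Suc t"] npos
      by (auto intro!: quant ny G_tan \<Gamma>_tan qs_tan)
    note r_tan = sum_tan[of "qs (Suc t)", OF qs_tan']
    note r_err = sum_err[of "qs (Suc t)" ?y "\<theta> * R (Suc t)", OF qs_err']
    \<comment> \<open>The exact gradient stays within R(t + 1) of the transported vector; the error
      of the sum adds the \<theta> / 2 in the radius.\<close>
    have r_close: "norm ((\<Sum>i\<in>UNIV. qs (Suc t) i) - \<Gamma> (q t)) \<le> (1 + \<theta> / 2) * R (Suc t)"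
    proof -
      have "norm (Gf ?y - \<Gamma> (q t)) \<le> norm (\<Gamma> (Gf ?x) - Gf ?y) + norm (\<Gamma> (q t) - \<Gamma> (Gf ?x))"
        using norm_triangle_ineq[of "Gf ?y - \<Gamma> (Gf ?x)" "\<Gamma> (Gf ?x) - \<Gamma> (q t)"]
        by (simp add: norm_minus_commute)
      also have "\<dots> \<le> s * R t + \<theta> * R t"
        using Gf_lip[OF nx ny lt] \<gamma>_dist q_err \<Gamma>_iso[OF q_tan Gf_tan[OF nx]] by (simp add: \<Gamma>_def)
      also have "\<dots> \<le> R (Suc t)" using budget by (simp add: algebra_simps)
      finally have "norm (Gf ?y - \<Gamma> (q t)) \<le> R (Suc t)" .
      then show ?thesis
        using r_err norm_triangle_ineq[of "(\<Sum>i\<in>UNIV. qs (Suc t) i) - Gf ?y" "Gf ?y - \<Gamma> (q t)"]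
        by (simp add: distrib_right)
    qed
    have pos: "0 < (1 + \<theta> / 2) * R (Suc t)" "0 < \<theta> * R (Suc t) / 2"
      using \<theta> Rpos[of "Suc t"] by (simp_all add: add_pos_pos)
    have "q (Suc t) \<in> tangent_space ?y"
      "norm (q (Suc t) - (\<Sum>i\<in>UNIV. qs (Suc t) i)) \<le> \<theta> * R (Suc t) / 2"
      unfolding q_Suc by (rule quant[OF ny r_tan \<Gamma>_tan[OF q_tan] r_close pos])+
    moreover from this have "norm (q (Suc t) - Gf ?y) \<le> \<theta> * R (Suc t)"
      using r_err norm_triangle_ineq[of "q (Suc t) - (\<Sum>i\<in>UNIV. qs (Suc t) i)"
          "(\<Sum>i\<in>UNIV. qs (Suc t) i) - Gf ?y"]
      by simp
    ultimately show ?case using ny dist_y qs_tan' qs_err' by (simp add: mult.assoc)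
  qed

  show ?thesis
  proof (intro allI conjI)
    fix t i
    have "(sphere_dist (x t) xstar)\<^sup>2 \<le> (\<rho> ^ t * D)\<^sup>2"
      using round[of t] star(1) by (intro power_mono) (auto simp: sphere_dist_bounds)
    also have "\<dots> = \<xi> ^ t * D\<^sup>2"
      by (simp add: \<xi> power_mult_distrib flip: power_mult) (simp add: mult.commute)
    finally show "(sphere_dist (x t) xstar)\<^sup>2 \<le> \<xi> ^ t * D\<^sup>2" .
    show "norm (qs t i - sphere_grad (fi i) (x t)) \<le> \<theta> * R t / (2 * ?n)"
      using round[of t] by (simp add: G_def)
    show "norm (q t - sphere_grad f (x t)) \<le> \<theta> * R t"
      using round[of t] by (simp add: Gf_def)
  qed
qed

end
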